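(* Let $K_0$ be an infinite field, let $K$ be a field extending $K_0$, and let $\mathcal{O}$ be a valuation ring on $K$ with $K_0 \subseteq \mathcal{O}$, with maximal ideal $\mathfrak{m}$ and residue field $k = \mathcal{O}/\mathfrak{m}$. Then the family of maps $$\varsigma_n : \operatorname{Sub}_K(K^n) \to \operatorname{Sub}_k(k^n), \qquad V \mapsto \big((V \cap \mathcal{O}^n) + \mathfrak{m}^n\big)/\mathfrak{m}^n \subseteq \mathcal{O}^n/\mathfrak{m}^n = k^n \qquad (n \ge 1)$$ is a $1$-inflator from $\operatorname{Dir}_K(K)$ to $\operatorname{Dir}_k(k)$.
   Context: Fix an infinite field $K_0$. For an object $A$ of a $K_0$-linear abelian category $\mathcal{C}$, $\operatorname{Sub}_{\mathcal{C}}(A^n)$ is the modular lattice of subobjects of $A^n$. The directory $\operatorname{Dir}_{\mathcal{C}}(A)$ is the multi-sorted structure $(\operatorname{Sub}_{\mathcal{C}}(A^n))_{n\ge1}$ with the lattice structure on each sort, the maps $\oplus: \operatorname{Sub}(A^n)\times\operatorname{Sub}(A^m)\to\operatorname{Sub}(A^{n+m})$, and the action of $GL_n(K_0)$ on $\operatorname{Sub}(A^n)$. A directory is any structure isomorphic to one of this form. If $\mathcal{C}$ is the category of left modules over a $K_0$-algebra $R$, one writes $\operatorname{Sub}_R$, $\operatorname{Dir}_R$. A morphism of directories $f:D_\bullet\to D'_\bullet$ is a family of maps $f_n:D_n\to D'_n$, each order-preserving and $GL_n(K_0)$-equivariant, with $f_{n+m}(x\oplus y)=f_n(x)\oplus f_m(y)$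 (the lattice operations need not be preserved). "Semisimple" means semisimple of finite length. A directory $\operatorname{Dir}_{\mathcal{C}}(B)$ is semisimple of length $d$ if $B$ is semisimple of length $d$. For a field $K\supseteq K_0$, a $d$-inflator on $K$ is a morphism of directories $\varsigma:\operatorname{Dir}_K(K)\to D_\bullet$, where $D_\bullet$ is semisimple of length $d$, such that $\ell(\varsigma_n(V))=d\cdot\dim_K(V)$ for all $n$ and all $V\in\operatorname{Sub}_K(K^n)$; here $\ell$ denotes length. *)

theory Defs
  imports
    "HOL-Library.Extended_Nat"
    "HOL-Algebra.Algebra"
    "Jordan_Normal_Form.Missing_VectorSpace"
begin

section \<open>Modules over a not necessarily commutative algebra\<close>

text \<open>The library locale \<open>module\<close> asks for a commutative ring of scalars. The library
  predicate \<open>Module.submodule\<close> does not, and is used below over arbitrary rings.\<close>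

locale left_module = R?: ring R + M?: abelian_group M
  for R :: "('r, 'x) ring_scheme" (structure) and M :: "('r, 'b, 'y) module_scheme" (structure) +
  assumes smult_closed: "\<lbrakk>a \<in> carrier R; x \<in> carrier M\<rbrakk> \<Longrightarrow> a \<odot>\<^bsub>M\<^esub> x \<in> carrier M"
    and smult_l_distr: "\<lbrakk>a \<in> carrier R; b \<in> carrier R; x \<in> carrier M\<rbrakk> \<Longrightarrow>
      (a \<oplus>\<^bsub>R\<^esub> b) \<odot>\<^bsub>M\<^esub> x = (a \<odot>\<^bsub>M\<^esub> x) \<oplus>\<^bsub>M\<^esub> (b \<odot>\<^bsub>M\<^esub> x)"
    and smult_r_distr: "\<lbrakk>a \<in> carrier R; x \<in> carrier M; y \<in> carrier M\<rbrakk> \<Longrightarrow>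
      a \<odot>\<^bsub>M\<^esub> (x \<oplus>\<^bsub>M\<^esub> y) = (a \<odot>\<^bsub>M\<^esub> x) \<oplus>\<^bsub>M\<^esub> (a \<odot>\<^bsub>M\<^esub> y)"
    and smult_assoc: "\<lbrakk>a \<in> carrier R; b \<in> carrier R; x \<in> carrier M\<rbrakk> \<Longrightarrow>
      (a \<otimes>\<^bsub>R\<^esub> b) \<odot>\<^bsub>M\<^esub> x = a \<odot>\<^bsub>M\<^esub> (b \<odot>\<^bsub>M\<^esub> x)"
    and smult_one: "x \<in> carrier M \<Longrightarrow> \<one>\<^bsub>R\<^esub> \<odot>\<^bsub>M\<^esub> x = x"

text \<open>An algebra over the field \<open>F\<close> is a ring \<open>R\<close> with a ring homomorphism \<open>\<iota>\<close> from \<open>F\<close> to the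
  centre of \<open>R\<close>.\<close>

definition field_algebra ::
  "('f, 'x) ring_scheme \<Rightarrow> ('r, 'y) ring_scheme \<Rightarrow> ('f \<Rightarrow> 'r) \<Rightarrow> bool" where
  "field_algebra F R \<iota> \<longleftrightarrow> field F \<and> ring R \<and> \<iota> \<in> ring_hom F R \<and>
     (\<forall>a\<in>carrier F. \<forall>r\<in>carrier R. \<iota> a \<otimes>\<^bsub>R\<^esub> r = r \<otimes>\<^bsub>R\<^esub> \<iota> a)"

definition self_module :: "('r, 'x) ring_scheme \<Rightarrow> ('r, 'r) module" where
  "self_module R = \<lparr>carrier = carrier R, monoid.mult = monoid.mult R, one = one R,
     ring.zero = ring.zero R, add = add R, smult = monoid.mult R\<rparr>"

text \<open>Elements of \<open>B\<^sup>n\<close> are extensional functions on \<open>{..<n}\<close>. The fields \<open>mult\<close> and \<open>one\<close>,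
  which the record type provides, play no role for modules.\<close>

definition module_power ::
  "nat \<Rightarrow> ('r, 'b, 'y) module_scheme \<Rightarrow> ('r, nat \<Rightarrow> 'b) module" where
  "module_power n B = \<lparr>carrier = {..<n} \<rightarrow>\<^sub>E carrier B, monoid.mult = undefined, one = undefined,
     ring.zero = (\<lambda>i\<in>{..<n}. \<zero>\<^bsub>B\<^esub>),
     add = (\<lambda>v w. \<lambda>i\<in>{..<n}. v i \<oplus>\<^bsub>B\<^esub> w i),
     smult = (\<lambda>r v. \<lambda>i\<in>{..<n}. r \<odot>\<^bsub>B\<^esub> v i)\<rparr>"

text \<open>The length of a module as an element of \<open>\<nat> \<union> {\<infinity>}\<close>: the supremum of all \<open>l\<close> for which there
  is a chain \<open>C\<^sub>0 \<subset> \<dots> \<subset> C\<^sub>l\<close> of submodules.\<close>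

definition module_length :: "('r, 'x) ring_scheme \<Rightarrow> ('r, 'b, 'y) module_scheme \<Rightarrow> enat" where
  "module_length R M = Sup {enat l | l. \<exists>C :: nat \<Rightarrow> 'b set.
     (\<forall>i\<le>l. Module.submodule (C i) R M) \<and> (\<forall>i<l. C i \<subset> C (Suc i))}"

definition simple_module :: "('r, 'x) ring_scheme \<Rightarrow> ('r, 'b, 'y) module_scheme \<Rightarrow> bool" where
  "simple_module R M \<longleftrightarrow> carrier M \<noteq> {\<zero>\<^bsub>M\<^esub>} \<and>
     (\<forall>N. Module.submodule N R M \<longrightarrow> N = {\<zero>\<^bsub>M\<^esub>} \<or> N = carrier M)"

text \<open>Semisimple of finite length: an internal direct sum of finitely many simple submodules.\<close>

definition semisimple_module :: "('r, 'x) ring_scheme \<Rightarrow> ('r, 'b, 'y) module_scheme \<Rightarrow> bool" where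
  "semisimple_module R M \<longleftrightarrow> (\<exists>(m :: nat) S.
     (\<forall>i<m. Module.submodule (S i) R M \<and> simple_module R (M\<lparr>carrier := S i\<rparr>)) \<and>
     bij_betw (\<lambda>s. \<Oplus>\<^bsub>M\<^esub>i\<in>{..<m}. s i) (\<Pi>\<^sub>E i\<in>{..<m}. S i) (carrier M))"

definition semisimple_of_length ::
  "('r, 'x) ring_scheme \<Rightarrow> ('r, 'b, 'y) module_scheme \<Rightarrow> nat \<Rightarrow> bool" where
  "semisimple_of_length R M d \<longleftrightarrow> semisimple_module R M \<and> module_length R M = enat d"


section \<open>Directories\<close>

definition mat_mult :: "('f, 'x) ring_scheme \<Rightarrow> nat \<Rightarrow>
    (nat \<Rightarrow> nat \<Rightarrow> 'f) \<Rightarrow> (nat \<Rightarrow> nat \<Rightarrow> 'f) \<Rightarrow> nat \<Rightarrow> nat \<Rightarrow> 'f" where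
  "mat_mult F n g h = (\<lambda>i\<in>{..<n}. \<lambda>j\<in>{..<n}. \<Oplus>\<^bsub>F\<^esub>l\<in>{..<n}. g i l \<otimes>\<^bsub>F\<^esub> h l j)"

definition mat_one :: "('f, 'x) ring_scheme \<Rightarrow> nat \<Rightarrow> nat \<Rightarrow> nat \<Rightarrow> 'f" where
  "mat_one F n = (\<lambda>i\<in>{..<n}. \<lambda>j\<in>{..<n}. if i = j then \<one>\<^bsub>F\<^esub> else \<zero>\<^bsub>F\<^esub>)"

definition GL :: "nat \<Rightarrow> ('f, 'x) ring_scheme \<Rightarrow> (nat \<Rightarrow> nat \<Rightarrow> 'f) set" where
  "GL n F = {g \<in> {..<n} \<rightarrow>\<^sub>E {..<n} \<rightarrow>\<^sub>E carrier F. \<exists>h \<in> {..<n} \<rightarrow>\<^sub>E {..<n} \<rightarrow>\<^sub>E carrier F.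
     mat_mult F n g h = mat_one F n \<and> mat_mult F n h g = mat_one F n}"

text \<open>The \<open>n\<close>-th sort is given as an ordered set; its lattice operations are
  those of the library, determined by the order. Only indices \<open>n \<ge> 1\<close> are meaningful.\<close>

record ('f, 's) directory =
  sort :: "nat \<Rightarrow> 's gorder"
  osum :: "nat \<Rightarrow> nat \<Rightarrow> 's \<Rightarrow> 's \<Rightarrow> 's"
  gl_act :: "nat \<Rightarrow> (nat \<Rightarrow> nat \<Rightarrow> 'f) \<Rightarrow> 's \<Rightarrow> 's"

definition Sub ::
  "('r, 'x) ring_scheme \<Rightarrow> ('r, 'b, 'y) module_scheme \<Rightarrow> 'b set gorder" where
  "Sub R M = \<lparr>carrier = {N. Module.submodule N R M}, eq = (=), le = (\<subseteq>)\<rparr>"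

definition vec_append :: "nat \<Rightarrow> nat \<Rightarrow> (nat \<Rightarrow> 'b) \<Rightarrow> (nat \<Rightarrow> 'b) \<Rightarrow> nat \<Rightarrow> 'b" where
  "vec_append n m v w = (\<lambda>i\<in>{..<n + m}. if i < n then v i else w (i - n))"

text \<open>\<open>Dir \<iota> R B\<close> is the directory of the left \<open>R\<close>-module \<open>B\<close>, for an algebra \<open>R\<close>
  with structure map \<open>\<iota>\<close>.\<close>

definition Dir :: "('f \<Rightarrow> 'r) \<Rightarrow> ('r, 'x) ring_scheme \<Rightarrow> ('r, 'b, 'y) module_scheme \<Rightarrow>
    ('f, (nat \<Rightarrow> 'b) set) directory" where
  "Dir \<iota> R B = \<lparr>sort = (\<lambda>n. Sub R (module_power n B)),
     osum = (\<lambda>n m V W. {vec_append n m v w | v w. v \<in> V \<and> w \<in> W}),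
     gl_act = (\<lambda>n g V. (\<lambda>v. \<lambda>i\<in>{..<n}. \<Oplus>\<^bsub>B\<^esub>j\<in>{..<n}. \<iota> (g i j) \<odot>\<^bsub>B\<^esub> v j) ` V)\<rparr>"

definition directory_morphism :: "('f, 'x) ring_scheme \<Rightarrow> ('f, 's) directory \<Rightarrow>
    ('f, 't) directory \<Rightarrow> (nat \<Rightarrow> 's \<Rightarrow> 't) \<Rightarrow> bool" where
  "directory_morphism F D D' f \<longleftrightarrow>
     (\<forall>n\<ge>1. f n \<in> carrier (sort D n) \<rightarrow> carrier (sort D' n)) \<and>
     (\<forall>n\<ge>1. isotone (sort D n) (sort D' n) (f n)) \<and>
     (\<forall>n\<ge>1. \<forall>g\<in>GL n F. \<forall>V\<in>carrier (sort D n). f n (gl_act D n g V) = gl_act D' n g (f n V)) \<and>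
     (\<forall>n\<ge>1. \<forall>m\<ge>1. \<forall>V\<in>carrier (sort D n). \<forall>W\<in>carrier (sort D m).
        f (n + m) (osum D n m V W) = osum D' n m (f n V) (f m W))"


section \<open>Inflators\<close>

text \<open>\<open>inflator d K\<^sub>0 K \<iota> R B \<sigma>\<close>: the family \<open>\<sigma>\<close> is a \<open>d\<close>-inflator on \<open>K\<close> with values in the
  directory of the left \<open>R\<close>-module \<open>B\<close>, where \<open>R\<close> is a \<open>K\<^sub>0\<close>-algebra via \<open>\<iota>\<close>. Working with module
  categories loses no generality: for a semisimple object \<open>B\<close> of finite length in an abelian
  category, the directory of \<open>B\<close> is isomorphic to that of a semisimple module of
  the same length over the opposite endomorphism ring of \<open>B\<close>.\<close>

definition inflator :: "nat \<Rightarrow> 'a set \<Rightarrow> ('a, 'x) ring_scheme \<Rightarrow> ('a \<Rightarrow> 'r) \<Rightarrow>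
    ('r, 'y) ring_scheme \<Rightarrow> ('r, 'b, 'z) module_scheme \<Rightarrow>
    (nat \<Rightarrow> (nat \<Rightarrow> 'a) set \<Rightarrow> (nat \<Rightarrow> 'b) set) \<Rightarrow> bool" where
  "inflator d K\<^sub>0 K \<iota> R B \<sigma> \<longleftrightarrow>
     field K \<and> subfield K\<^sub>0 K \<and> infinite K\<^sub>0 \<and>
     field_algebra (K\<lparr>carrier := K\<^sub>0\<rparr>) R \<iota> \<and> left_module R B \<and>
     semisimple_of_length R B d \<and>
     directory_morphism (K\<lparr>carrier := K\<^sub>0\<rparr>) (Dir (\<lambda>a. a) K (self_module K)) (Dir \<iota> R B) \<sigma> \<and>
     (\<forall>n\<ge>1. \<forall>V. Module.submodule V K (module_power n (self_module K)) \<longrightarrow>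
        module_length R ((module_power n B)\<lparr>carrier := \<sigma> n V\<rparr>) =
        enat (d * vectorspace.dim K ((module_power n (self_module K))\<lparr>carrier := V\<rparr>)))"


section \<open>Valuation rings and specialization\<close>

definition valuation_ring :: "'a set \<Rightarrow> ('a, 'x) ring_scheme \<Rightarrow> bool" where
  "valuation_ring \<O> K \<longleftrightarrow> subring \<O> K \<and>
     (\<forall>x\<in>carrier K. x \<noteq> \<zero>\<^bsub>K\<^esub> \<longrightarrow> x \<in> \<O> \<or> inv\<^bsub>K\<^esub> x \<in> \<O>)"

definition residue_field :: "('a, 'x) ring_scheme \<Rightarrow> 'a set \<Rightarrow> 'a set \<Rightarrow> 'a set ring" where
  "residue_field K \<O> \<mm> = K\<lparr>carrier := \<O>\<rparr> Quot \<mm>"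

definition residue :: "('a, 'x) ring_scheme \<Rightarrow> 'a set \<Rightarrow> 'a set \<Rightarrow> 'a \<Rightarrow> 'a set" where
  "residue K \<O> \<mm> a = \<mm> +>\<^bsub>K\<lparr>carrier := \<O>\<rparr>\<^esub> a"

text \<open>The identification of \<open>\<O>\<^sup>n/\<mm>\<^sup>n\<close> with \<open>k\<^sup>n\<close> is coordinatewise, so the submodule
  \<open>((V \<inter> \<O>\<^sup>n) + \<mm>\<^sup>n)/\<mm>\<^sup>n\<close> becomes an image under the coordinatewise residue map.\<close>

definition specialization ::
  "('a, 'x) ring_scheme \<Rightarrow> 'a set \<Rightarrow> 'a set \<Rightarrow> nat \<Rightarrow> (nat \<Rightarrow> 'a) set \<Rightarrow> (nat \<Rightarrow> 'a set) set" where
  "specialization K \<O> \<mm> n V = (\<lambda>v. \<lambda>i\<in>{..<n}. residue K \<O> \<mm> (v i)) `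
     ((V \<inter> ({..<n} \<rightarrow>\<^sub>E \<O>)) <+>\<^bsub>module_power n (self_module K)\<^esub> ({..<n} \<rightarrow>\<^sub>E \<mm>))"

end

theory Submission
  imports Defs
begin

text \<open>Every \<open>V \<subseteq> K\<^sup>n\<close> has a basis of vectors in \<open>\<O>\<^sup>n\<close> whose restriction to some set \<open>I\<close> of
  coordinates is the standard basis. The coefficients of \<open>w \<in> V\<close> in such a basis are the coordinates
  of \<open>w\<close> in \<open>I\<close>, so \<open>V \<inter> \<O>\<^sup>n\<close> is the \<open>\<O>\<close>-span of the basis, and reduction modulo \<open>\<mm>\<close> turns it into a
  basis of the same kind of the specialization of \<open>V\<close>. Hence dimensions are preserved. Equivariance
  holds because matrices in \<open>GL\<^sub>n(K\<^sub>0)\<close> and their inverses preserve \<open>\<O>\<^sup>n\<close>.\<close>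

text \<open>The inflator condition compares two differently defined numbers: a vector space
  dimension over \<open>K\<close> and a supremum of chain lengths over the residue field. The
  normalised bases make them comparable, since both turn out to be the cardinality of one set
  \<open>I\<close>. That set depends on choices, but it passes unchanged from \<open>V\<close> to
  its specialization. For this reason the facts about submodules and lengths are stated over a
  general ring or field and then used over the residue field as well as over \<open>K\<close>.
  Taking integral vectors does not in general commute with sums of subspaces, nor with invertible
  matrices over \<open>K\<close>. It does commute with direct sums, which separate the coordinates,
  and this is why a morphism of directories is the right notion here rather than a lattice
  homomorphism.\<close>

section \<open>Submodules of powers of a ring\<close>

text \<open>Length is defined through \<open>Module.submodule\<close>, whereas span and dimension
  rest on \<open>LinearCombinations.submodule\<close>. The second notion does not mention negatives;
  they come from scaling by \<open>\<ominus> \<one>\<close>.\<close>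

lemma (in module) submodule_iff_closed:
  "Module.submodule N R M \<longleftrightarrow> LinearCombinations.submodule R N M"
proof
  assume "Module.submodule N R M"
  note N = this
  have "\<zero>\<^bsub>M\<^esub> \<in> N"
    using subgroup.one_closed[OF Module.submodule.axioms(1)[OF N]] by simp
  then show "LinearCombinations.submodule R N M"
    using submoduleE(1,4,5)[OF N] by (intro LinearCombinations.submodule.intro module_axioms) blast+
next
  assume N: "LinearCombinations.submodule R N M"
  have "\<ominus>\<^bsub>M\<^esub> a \<in> N" if "a \<in> N" for a
  proof -
    have "a \<in> carrier M" using N that by (auto simp: LinearCombinations.submodule_def)
    then have "\<ominus>\<^bsub>M\<^esub> a = (\<ominus> \<one>) \<odot>\<^bsub>M\<^esub> a" by (simp add: smult_l_minus)
    then show ?thesis using N that by (simp add: LinearCombinations.submodule_def)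
  qed
  with N show "Module.submodule N R M"
    by (intro submoduleI) (auto simp: LinearCombinations.submodule_def)
qed

text \<open>The length of a subspace is taken in the ambient record with its carrier replaced. This
  lets chains there be handled as chains of submodules of the full power.\<close>

lemma (in module) submodule_of_submodule_iff:
  assumes N: "Module.submodule N R M"
  shows "Module.submodule C R (M\<lparr>carrier := N\<rparr>) \<longleftrightarrow> Module.submodule C R M \<and> C \<subseteq> N"
proof -
  have N': "LinearCombinations.submodule R N M" using N submodule_iff_closed by blast
  interpret N: module R "M\<lparr>carrier := N\<rparr>" using submodule_is_module[OF N'] .
  have "LinearCombinations.submodule R C (M\<lparr>carrier := N\<rparr>) \<longleftrightarrow>
      LinearCombinations.submodule R C M \<and> C \<subseteq> N"
    using submoduleE(1)[OF N] N.module_axioms module_axioms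
    unfolding LinearCombinations.submodule_def by (simp, blast)
  then show ?thesis unfolding N.submodule_iff_closed submodule_iff_closed .
qed

lemma PiE_coord: "v \<in> {..<n} \<rightarrow>\<^sub>E A \<Longrightarrow> i < n \<Longrightarrow> v i \<in> A"
  by (auto simp: PiE_iff)

lemma power_self_simps:
  "carrier (module_power n (self_module R)) = {..<n} \<rightarrow>\<^sub>E carrier R"
  "\<zero>\<^bsub>module_power n (self_module R)\<^esub> = (\<lambda>i\<in>{..<n}. \<zero>\<^bsub>R\<^esub>)"
  "v \<oplus>\<^bsub>module_power n (self_module R)\<^esub> w = (\<lambda>i\<in>{..<n}. v i \<oplus>\<^bsub>R\<^esub> w i)"
  "r \<odot>\<^bsub>module_power n (self_module R)\<^esub> v = (\<lambda>i\<in>{..<n}. r \<otimes>\<^bsub>R\<^esub> v i)"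
  by (simp_all add: module_power_def self_module_def)

lemma (in cring) module_self: "module R (self_module R)"
proof (rule moduleI)
  show "cring R" by (rule is_cring)
  show "abelian_group (self_module R)"
  proof (rule abelian_groupI, goal_cases)
    case (6 x)
    then show ?case by (intro bexI[of _ "\<ominus> x"]) (simp_all add: self_module_def l_neg)
  qed (simp_all add: self_module_def a_ac)
qed (simp_all add: self_module_def l_distr r_distr m_assoc)

lemma (in cring) module_power_self: "module R (module_power n (self_module R))"
proof (rule moduleI)
  show "cring R" by (rule is_cring)
  show "abelian_group (module_power n (self_module R))"
  proof (rule abelian_groupI, unfold power_self_simps, goal_cases)
    case (3 x y z)
    then show ?case by (intro restrict_ext) (simp add: PiE_coord add.m_assoc)
  next
    case (4 x y)
    then show ?case by (intro restrict_ext) (simp add: PiE_coord a_comm)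
  next
    case (5 x)
    then show ?case by (intro PiE_ext[OF _ 5]) (simp_all add: PiE_coord)
  next
    case (6 x)
    then show ?case
      by (intro bexI[where x="\<lambda>i\<in>{..<n}. \<ominus> x i"] restrict_ext) (simp_all add: PiE_coord l_neg)
  qed (simp_all add: PiE_coord)
next
  fix x assume "x \<in> carrier (module_power n (self_module R))"
  then have "x \<in> {..<n} \<rightarrow>\<^sub>E carrier R" by (simp add: power_self_simps)
  then show "\<one> \<odot>\<^bsub>module_power n (self_module R)\<^esub> x = x"
    unfolding power_self_simps by (intro PiE_ext[of _ "{..<n}" "\<lambda>_. carrier R"]) (simp_all add: PiE_coord)
qed (simp_all add: power_self_simps PiE_coord l_distr r_distr m_assoc cong: restrict_cong)

lemma (in cring) submodule_power_iff:
  "Module.submodule V R (module_power n (self_module R)) \<longleftrightarrow>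
    V \<subseteq> {..<n} \<rightarrow>\<^sub>E carrier R \<and> (\<lambda>i\<in>{..<n}. \<zero>) \<in> V \<and>
    (\<forall>v\<in>V. \<forall>w\<in>V. (\<lambda>i\<in>{..<n}. v i \<oplus> w i) \<in> V) \<and>
    (\<forall>r\<in>carrier R. \<forall>v\<in>V. (\<lambda>i\<in>{..<n}. r \<otimes> v i) \<in> V)"
  using module_power_self[of n]
  unfolding module.submodule_iff_closed[OF module_power_self] LinearCombinations.submodule_def
    power_self_simps
  by blast

lemma (in cring) submodule_power_coord:
  assumes "Module.submodule V R (module_power n (self_module R))" "v \<in> V" "l < n"
  shows "v l \<in> carrier R"
  using assms by (auto simp: submodule_power_iff intro: PiE_coord)

lemma (in cring) submodule_power_lincomb2:
  assumes V: "Module.submodule V R (module_power n (self_module R))"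
    and "u \<in> V" "w \<in> V" "a \<in> carrier R" "b \<in> carrier R"
  shows "(\<lambda>l\<in>{..<n}. a \<otimes> u l \<oplus> b \<otimes> w l) \<in> V"
proof -
  have "(\<lambda>l\<in>{..<n}. a \<otimes> u l) \<in> V" "(\<lambda>l\<in>{..<n}. b \<otimes> w l) \<in> V"
    using assms by (auto simp: submodule_power_iff)
  then have "(\<lambda>i\<in>{..<n}. (\<lambda>l\<in>{..<n}. a \<otimes> u l) i \<oplus> (\<lambda>l\<in>{..<n}. b \<otimes> w l) i) \<in> V"
    using V unfolding submodule_power_iff by blast
  moreover have "(\<lambda>i\<in>{..<n}. (\<lambda>l\<in>{..<n}. a \<otimes> u l) i \<oplus> (\<lambda>l\<in>{..<n}. b \<otimes> w l) i)
      = (\<lambda>l\<in>{..<n}. a \<otimes> u l \<oplus> b \<otimes> w l)"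
    by (rule restrict_ext) simp
  ultimately show ?thesis by simp
qed

lemma (in cring) submodule_power_lincomb:
  assumes V: "Module.submodule V R (module_power n (self_module R))"
    and "finite I" "c \<in> I \<rightarrow> carrier R" "\<And>i. i \<in> I \<Longrightarrow> v i \<in> V"
  shows "(\<lambda>l\<in>{..<n}. \<Oplus>i\<in>I. c i \<otimes> v i l) \<in> V"
  using assms(2-)
proof (induction I)
  case empty
  then show ?case using V unfolding submodule_power_iff finsum_empty by blast
next
  case (insert i I)
  let ?s = "\<lambda>l\<in>{..<n}. \<Oplus>i\<in>I. c i \<otimes> v i l"
  have vc: "v j l \<in> carrier R" if "j \<in> insert i I" "l < n" for j l
    using submodule_power_coord[OF V] insert.prems(2) that by blast
  have "(\<lambda>l\<in>{..<n}. c i \<otimes> v i l \<oplus> \<one> \<otimes> ?s l) \<in> V"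
    using insert by (intro submodule_power_lincomb2[OF V]) auto
  moreover have "(\<lambda>l\<in>{..<n}. c i \<otimes> v i l \<oplus> \<one> \<otimes> ?s l)
      = (\<lambda>l\<in>{..<n}. \<Oplus>i\<in>insert i I. c i \<otimes> v i l)"
  proof (rule restrict_ext)
    fix l assume "l \<in> {..<n}"
    moreover have "(\<lambda>i. c i \<otimes> v i l) \<in> I \<rightarrow> carrier R" "c i \<otimes> v i l \<in> carrier R"
      using insert.prems \<open>l \<in> {..<n}\<close> vc by auto
    ultimately show "c i \<otimes> v i l \<oplus> \<one> \<otimes> ?s l = (\<Oplus>i\<in>insert i I. c i \<otimes> v i l)"
      using insert.hyps by (simp add: finsum_insert)
  qed
  ultimately show ?case by (simp only:)
qed

section \<open>Bases normalised at a set of coordinates\<close>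

text \<open>The last clause makes the restriction of \<open>V\<close> to the coordinates in
  \<open>I\<close> injective, and the clause before it makes it onto when \<open>V\<close> is a
  submodule. Injectivity stands in for spanning: it involves no sums, is easy to negate in a
  maximality argument, and yields the expansion of every vector. Over a field this is a reduced
  echelon basis without an order on the pivots.\<close>

definition pivot_basis ::
    "('a, 'x) ring_scheme \<Rightarrow> nat \<Rightarrow> (nat \<Rightarrow> 'a) set \<Rightarrow> nat set \<Rightarrow> (nat \<Rightarrow> nat \<Rightarrow> 'a) \<Rightarrow> bool" where
  "pivot_basis R n V I v \<longleftrightarrow> I \<subseteq> {..<n} \<and> (\<forall>i\<in>I. v i \<in> V) \<and>
     (\<forall>i\<in>I. \<forall>j\<in>I. v i j = (if i = j then \<one>\<^bsub>R\<^esub> else \<zero>\<^bsub>R\<^esub>)) \<and>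
     (\<forall>w\<in>V. (\<forall>i\<in>I. w i = \<zero>\<^bsub>R\<^esub>) \<longrightarrow> (\<forall>l<n. w l = \<zero>\<^bsub>R\<^esub>))"

text \<open>Subtracting from \<open>w\<close> the combination with coefficients \<open>w i\<close>
  leaves a vector of \<open>V\<close> that vanishes on \<open>I\<close>, and such a vector is
  zero.\<close>

lemma (in cring) pivot_basis_expansion:
  assumes V: "Module.submodule V R (module_power n (self_module R))"
    and b: "pivot_basis R n V I v" and w: "w \<in> V" and l: "l < n"
  shows "w l = (\<Oplus>i\<in>I. w i \<otimes> v i l)"
proof -
  let ?s = "\<lambda>l\<in>{..<n}. \<Oplus>i\<in>I. w i \<otimes> v i l"
  let ?u = "\<lambda>l\<in>{..<n}. \<one> \<otimes> w l \<oplus> (\<ominus> \<one>) \<otimes> ?s l"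
  have I: "I \<subseteq> {..<n}" "finite I" using b by (auto simp: pivot_basis_def intro: finite_subset)
  have wc: "w j \<in> carrier R" if "j < n" for j
    using submodule_power_coord[OF V w that] .
  have vc: "v i j \<in> carrier R" if "i \<in> I" "j < n" for i j
    using submodule_power_coord[OF V] b that by (auto simp: pivot_basis_def)
  have s: "?s \<in> V"
    using b I wc by (intro submodule_power_lincomb[OF V]) (auto simp: pivot_basis_def)
  then have u: "?u \<in> V" using w by (intro submodule_power_lincomb2[OF V]) (assumption | simp)+
  have sc: "?s j \<in> carrier R" if "j < n" for j
    using submodule_power_coord[OF V s that] .
  have "?u j = \<zero>" if j: "j \<in> I" for j
  proof -
    have "(\<Oplus>i\<in>I. w i \<otimes> v i j) = (\<Oplus>i\<in>I. if j = i then w i else \<zero>)"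
      using b j I wc by (intro finsum_cong') (auto simp: pivot_basis_def)
    also have "\<dots> = w j" using j I wc by (intro finsum_singleton) auto
    finally show ?thesis using j I wc[of j] by (auto simp: l_minus r_neg)
  qed
  then have "?u l = \<zero>" using b u l unfolding pivot_basis_def by blast
  then have "w l \<oplus> \<ominus> (?s l) = \<zero>" using l sc[OF l] wc by (simp add: l_minus)
  then show ?thesis using l sc[OF l] wc by (metis (no_types, lifting) lessThan_iff minus_eq r_right_minus_eq restrict_apply)
qed

section \<open>Length and dimension\<close>

lemma module_length_eqI:
  assumes chain: "\<And>i. i \<le> d \<Longrightarrow> Module.submodule (C i) R M" "\<And>i. i < d \<Longrightarrow> C i \<subset> C (Suc i)"
    and bound: "\<And>l D. \<lbrakk>\<And>i. i \<le> l \<Longrightarrow> Module.submodule (D i) R M; \<And>i. i < l \<Longrightarrow> D i \<subset> D (Suc i)\<rbrakk>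
      \<Longrightarrow> l \<le> d"
  shows "module_length R M = enat d"
  unfolding module_length_def
proof (rule antisym)
  show "enat d \<le> Sup {enat l | l. \<exists>C. (\<forall>i\<le>l. Module.submodule (C i) R M) \<and> (\<forall>i<l. C i \<subset> C (Suc i))}"
    using chain by (intro Sup_upper) blast
  show "Sup {enat l | l. \<exists>C. (\<forall>i\<le>l. Module.submodule (C i) R M) \<and> (\<forall>i<l. C i \<subset> C (Suc i))} \<le> enat d"
    using bound by (intro Sup_least) fastforce
qed

text \<open>In a strict chain of subspaces of a space with a basis normalised at \<open>I\<close>, the sets of leading
  indices in \<open>I\<close> strictly increase, so the chain has at most \<open>card I\<close> steps.\<close>

definition leading_indices :: "('a, 'x) ring_scheme \<Rightarrow> nat set \<Rightarrow> (nat \<Rightarrow> 'a) set \<Rightarrow> nat set" where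
  "leading_indices R I U = {i\<in>I. \<exists>u\<in>U. u i \<noteq> \<zero>\<^bsub>R\<^esub> \<and> (\<forall>j\<in>I. j < i \<longrightarrow> u j = \<zero>\<^bsub>R\<^esub>)}"

text \<open>Suppose the sets agree, and among the vectors of \<open>B\<close> outside
  \<open>A\<close> take \<open>w\<close> with the largest leading index \<open>i\<close>. Some
  \<open>u\<close> in \<open>A\<close> also leads at \<open>i\<close>, and subtracting a multiple of
  \<open>u\<close> cancels that coordinate. The result still lies in \<open>B\<close> outside
  \<open>A\<close>, but it leads later.\<close>

lemma (in field) leading_indices_psubset:
  assumes V: "Module.submodule V R (module_power n (self_module R))" and b: "pivot_basis R n V I v"
    and A: "Module.submodule A R (module_power n (self_module R))"
    and B: "Module.submodule B R (module_power n (self_module R))"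
    and AB: "A \<subset> B" and BV: "B \<subseteq> V"
  shows "leading_indices R I A \<subset> leading_indices R I B"
proof (rule ccontr)
  assume "\<not> ?thesis"
  moreover have "leading_indices R I A \<subseteq> leading_indices R I B"
    using AB unfolding leading_indices_def by blast
  ultimately have eq: "leading_indices R I A = leading_indices R I B" by blast
  have I: "I \<subseteq> {..<n}" "finite I" using b by (auto simp: pivot_basis_def intro: finite_subset)
  define L where "L = {i\<in>I. \<exists>u\<in>B - A. u i \<noteq> \<zero> \<and> (\<forall>j\<in>I. j < i \<longrightarrow> u j = \<zero>)}"
  have lead: "\<exists>i\<in>L. u i \<noteq> \<zero> \<and> (\<forall>j\<in>I. j < i \<longrightarrow> u j = \<zero>)" if u: "u \<in> B - A" for u
  proof -
    \<comment> \<open>A vector of \<open>V\<close> that vanishes on \<open>I\<close> is zero and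
      hence lies in \<open>A\<close>, so a vector outside \<open>A\<close> does have a leading
      index.\<close>
    have "\<exists>i\<in>I. u i \<noteq> \<zero>"
    proof (rule ccontr)
      assume "\<not> ?thesis"
      then have "\<forall>l<n. u l = \<zero>" using b u BV unfolding pivot_basis_def by blast
      moreover have "u \<in> {..<n} \<rightarrow>\<^sub>E carrier R" using B u unfolding submodule_power_iff by blast
      ultimately have "u = (\<lambda>i\<in>{..<n}. \<zero>)" by (auto simp: PiE_iff extensional_def fun_eq_iff)
      then show False using A u unfolding submodule_power_iff by blast
    qed
    then have "\<exists>i. i \<in> I \<and> u i \<noteq> \<zero>" by blast
    then obtain i where "i \<in> I" "u i \<noteq> \<zero>" "\<And>j. j < i \<Longrightarrow> \<not> (j \<in> I \<and> u j \<noteq> \<zero>)"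
      using exists_least_iff[of "\<lambda>i. i \<in> I \<and> u i \<noteq> \<zero>"] by blast
    then show ?thesis using u unfolding L_def by blast
  qed
  obtain u0 where "u0 \<in> B - A" using AB by blast
  then have "L \<noteq> {}" "finite L" using lead[of u0] I by (auto simp: L_def)
  then have maxL: "Max L \<in> L" "\<And>j. j \<in> L \<Longrightarrow> j \<le> Max L" by auto
  define i where "i = Max L"
  have "i \<in> L" using maxL(1) by (simp add: i_def)
  then have "i \<in> I" "\<exists>w\<in>B - A. w i \<noteq> \<zero> \<and> (\<forall>j\<in>I. j < i \<longrightarrow> w j = \<zero>)"
    unfolding L_def by simp_all
  then obtain w where w: "i \<in> I" "w \<in> B" "w \<notin> A" "w i \<noteq> \<zero>" "\<forall>j\<in>I. j < i \<longrightarrow> w j = \<zero>"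
    by blast
  then have "i \<in> leading_indices R I B" unfolding leading_indices_def by blast
  then have "i \<in> leading_indices R I A" using eq by simp
  then obtain u where u: "u \<in> A" "u i \<noteq> \<zero>" "\<forall>j\<in>I. j < i \<longrightarrow> u j = \<zero>"
    unfolding leading_indices_def by blast
  have coord: "w j \<in> carrier R" "u j \<in> carrier R" if "j \<in> I" for j
    using submodule_power_coord[OF B w(2)] submodule_power_coord[OF A u(1)] that I by auto
  \<comment> \<open>The factor for which \<open>w i \<oplus> c \<otimes> u i\<close>
    vanishes.\<close>
  define c where "c = \<ominus> (w i \<otimes> inv (u i))"
  have ui: "inv (u i) \<in> carrier R" "inv (u i) \<otimes> u i = \<one>"
    using u(2) coord w(1) by (auto simp: field_Units)
  have c: "c \<in> carrier R" using coord w(1) ui by (simp add: c_def)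
  define x where "x = (\<lambda>l\<in>{..<n}. \<one> \<otimes> w l \<oplus> c \<otimes> u l)"
  have xB: "x \<in> B" unfolding x_def using u(1) w(2) AB c by (intro submodule_power_lincomb2[OF B]) auto
  have xA: "x \<notin> A"
  proof
    assume "x \<in> A"
    then have "(\<lambda>l\<in>{..<n}. \<one> \<otimes> x l \<oplus> (\<ominus> c) \<otimes> u l) \<in> A"
      using u c by (intro submodule_power_lincomb2[OF A]) auto
    moreover have "(\<lambda>l\<in>{..<n}. \<one> \<otimes> x l \<oplus> (\<ominus> c) \<otimes> u l) = w"
    proof (rule PiE_ext[of _ "{..<n}" "\<lambda>_. carrier R"])
      show "w \<in> {..<n} \<rightarrow>\<^sub>E carrier R" using B w(2) unfolding submodule_power_iff by blast
      show "(\<lambda>l\<in>{..<n}. \<one> \<otimes> x l \<oplus> (\<ominus> c) \<otimes> u l) \<in> {..<n} \<rightarrow>\<^sub>E carrier R"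
        using calculation A unfolding submodule_power_iff by blast
      fix l assume "l \<in> {..<n}"
      moreover from this have "w l \<in> carrier R" "c \<otimes> u l \<in> carrier R"
        using submodule_power_coord[OF B w(2)] submodule_power_coord[OF A u(1)] c by auto
      ultimately show "(\<lambda>l\<in>{..<n}. \<one> \<otimes> x l \<oplus> (\<ominus> c) \<otimes> u l) l = w l"
        using submodule_power_coord[OF A u(1), of l] c by (simp add: x_def l_minus a_assoc r_neg)
    qed
    ultimately show False using w(3) by simp
  qed
  have x0: "x j = \<zero>" if "j \<in> I" "j \<le> i" for j
  proof (cases "j = i")
    case True
    have "c \<otimes> u i = \<ominus> w i" using coord[OF w(1)] ui by (simp add: c_def l_minus m_assoc)
    then show ?thesis using True coord[OF w(1)] I w(1) by (auto simp: x_def r_neg)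
  next
    case False
    then show ?thesis using that u(3) w(5) c I by (auto simp: x_def)
  qed
  obtain j where "j \<in> L" "x j \<noteq> \<zero>" using lead xA xB by blast
  then show False using maxL(2)[of j] x0[of j] by (auto simp: L_def i_def)
qed

text \<open>An explicit flag attains \<open>card I\<close>, and the leading indices, all inside
  \<open>I\<close>, bound every other chain.\<close>

lemma (in field) module_length_pivot_basis:
  assumes V: "Module.submodule V R (module_power n (self_module R))" and b: "pivot_basis R n V I v"
  shows "module_length R ((module_power n (self_module R))\<lparr>carrier := V\<rparr>) = enat (card I)"
proof -
  let ?M = "module_power n (self_module R)"
  have I: "I \<subseteq> {..<n}" "finite I" using b by (auto simp: pivot_basis_def intro: finite_subset)
  obtain e where e: "bij_betw e {..<card I} I"
    using ex_bij_betw_nat_finite[OF I(2)] by (auto simp: atLeast0LessThan)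
  have eI: "e i \<in> I" if "i < card I" for i using e that by (auto simp: bij_betw_def)
  \<comment> \<open>The coordinates at the pivots from number \<open>j\<close> on must vanish. The
    flag thus runs from the zero subspace at \<open>j = 0\<close> to \<open>V\<close> at
    \<open>j = card I\<close>, and \<open>v (e j)\<close> witnesses that step \<open>j\<close> is
    strict.\<close>
  define C where "C = (\<lambda>j. {w\<in>V. \<forall>i. j \<le> i \<and> i < card I \<longrightarrow> w (e i) = \<zero>})"
  have sub: "Module.submodule D R (?M\<lparr>carrier := V\<rparr>) \<longleftrightarrow> Module.submodule D R ?M \<and> D \<subseteq> V" for D
    by (rule module.submodule_of_submodule_iff[OF module_power_self V])
  show ?thesis
  proof (rule module_length_eqI)
    fix j
    have "e i < n" if "i < card I" for i using eI[OF that] I by auto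
    then have "Module.submodule (C j) R ?M"
      using V unfolding submodule_power_iff C_def by auto
    then show "Module.submodule (C j) R (?M\<lparr>carrier := V\<rparr>)"
      unfolding sub by (auto simp: C_def)
  next
    fix j assume j: "j < card I"
    have "v (e j) (e i) = (if i = j then \<one> else \<zero>)" if "i < card I" for i
      using b eI j that e by (auto simp: pivot_basis_def bij_betw_def inj_on_def)
    then have "v (e j) \<in> C (Suc j)" "v (e j) \<notin> C j"
      using b eI j by (auto simp: pivot_basis_def C_def)
    moreover have "C j \<subseteq> C (Suc j)" by (auto simp: C_def)
    ultimately show "C j \<subset> C (Suc j)" by blast
  next
    fix l D assume D: "\<And>i. i \<le> l \<Longrightarrow> Module.submodule (D i) R (?M\<lparr>carrier := V\<rparr>)"
      "\<And>i. i < l \<Longrightarrow> D i \<subset> D (Suc i)"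
    have fin: "finite (leading_indices R I U)" "card (leading_indices R I U) \<le> card I" for U
      using I by (auto simp: leading_indices_def intro: card_mono)
    \<comment> \<open>Each strict inclusion adds at least one leading index.\<close>
    have "i \<le> card (leading_indices R I (D i))" if "i \<le> l" for i
      using that
    proof (induction i)
      case (Suc i)
      have "leading_indices R I (D i) \<subset> leading_indices R I (D (Suc i))"
        using D(1)[of i] D(1)[of "Suc i"] D(2)[of i] Suc.prems
        by (intro leading_indices_psubset[OF V b]) (auto simp: sub)
      then have "card (leading_indices R I (D i)) < card (leading_indices R I (D (Suc i)))"
        using fin by (intro psubset_card_mono)
      then show ?case using Suc by simp
    qed simp
    then show "l \<le> card I" using fin(2) le_trans by blast
  qed
qed

section \<open>Dimension of a space with a normalised basis\<close>

lemma (in cring) finsum_power_coord: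
  assumes "finite A" "f \<in> A \<rightarrow> ({..<n} \<rightarrow>\<^sub>E carrier R)" "l < n"
  shows "(\<Oplus>\<^bsub>module_power n (self_module R)\<^esub>x\<in>A. f x) l = (\<Oplus>x\<in>A. f x l)"
proof -
  interpret M: module R "module_power n (self_module R)" by (rule module_power_self)
  show ?thesis
    using assms
  proof (induction A)
    case empty
    then show ?case by (simp add: power_self_simps)
  next
    case (insert x A)
    have "f \<in> A \<rightarrow> carrier (module_power n (self_module R))"
      "f x \<in> carrier (module_power n (self_module R))"
      using insert.prems(1) by (auto simp: power_self_simps)
    moreover have "(\<lambda>x. f x l) \<in> A \<rightarrow> carrier R" "f x l \<in> carrier R"
      using insert.prems PiE_coord[OF _ insert.prems(2)] by (blast | simp)+
    ultimately show ?case using insert by (simp add: M.finsum_insert power_self_simps)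
  qed
qed

text \<open>The notion of basis used by \<open>dim\<close> is a set of vectors, with coefficients
  attached to the vectors themselves. The family \<open>v\<close> is therefore handled through its
  image, and its injectivity gives that image the cardinality of \<open>I\<close>.\<close>

lemma (in field) dim_pivot_basis:
  assumes V: "Module.submodule V R (module_power n (self_module R))" and b: "pivot_basis R n V I v"
  shows "vectorspace.dim R ((module_power n (self_module R))\<lparr>carrier := V\<rparr>) = card I"
proof -
  let ?M = "module_power n (self_module R)"
  interpret M: module R ?M by (rule module_power_self)
  have V': "LinearCombinations.submodule R V ?M" using V M.submodule_iff_closed by blast
  interpret W: vectorspace R "?M\<lparr>carrier := V\<rparr>"
    using M.submodule_is_module[OF V'] by (simp add: vectorspace_def field_axioms)
  have I: "I \<subseteq> {..<n}" "finite I" using b by (auto simp: pivot_basis_def intro: finite_subset)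
  have vV: "v ` I \<subseteq> V" using b by (auto simp: pivot_basis_def)
  have VM: "V \<subseteq> {..<n} \<rightarrow>\<^sub>E carrier R" using V unfolding submodule_power_iff by blast
  have vc: "v i l \<in> carrier R" if "i \<in> I" "l < n" for i l
    using submodule_power_coord[OF V _ that(2)] vV that(1) by blast
  \<comment> \<open>For distinct \<open>i\<close> and \<open>j\<close> the vectors
    \<open>v i\<close> and \<open>v j\<close> already differ at a pivot.\<close>
  have inj: "inj_on v I"
  proof (rule inj_onI)
    fix i j assume "i \<in> I" "j \<in> I" "v i = v j"
    moreover have "\<forall>i\<in>I. \<forall>j\<in>I. v i j = (if i = j then \<one> else \<zero>)"
      using b by (simp add: pivot_basis_def)
    ultimately show "i = j" by (metis one_not_zero)
  qed
  have comb: "W.lincomb a (v ` I) l = (\<Oplus>i\<in>I. a (v i) \<otimes> v i l)"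
    if a: "a \<in> v ` I \<rightarrow> carrier R" and l: "l < n" for a l
  proof -
    have aV: "(\<lambda>x. a x \<odot>\<^bsub>?M\<^esub> x) \<in> v ` I \<rightarrow> V"
      using a vV V unfolding submodule_power_iff power_self_simps by blast
    \<comment> \<open>Sums formed inside \<open>V\<close> agree with sums in the full power, where
      they are evaluated coordinate by coordinate.\<close>
    have "W.lincomb a (v ` I) l = (\<Oplus>\<^bsub>?M\<^esub>x\<in>v ` I. a x \<odot>\<^bsub>?M\<^esub> x) l"
      unfolding W.lincomb_def using M.finsum_not_depend[OF _ vV V' aV] I by simp
    also have "\<dots> = (\<Oplus>x\<in>v ` I. (a x \<odot>\<^bsub>?M\<^esub> x) l)"
      using aV VM I l by (intro finsum_power_coord) blast+
    also have "\<dots> = (\<Oplus>x\<in>v ` I. a x \<otimes> x l)"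
      using l a vc by (intro finsum_cong') (auto simp: power_self_simps)
    also have "\<dots> = (\<Oplus>i\<in>I. a (v i) \<otimes> v i l)"
      using l a vc inj by (intro finsum_reindex) auto
    finally show ?thesis .
  qed
  have "W.basis (v ` I)"
    unfolding W.basis_def
  proof (intro conjI)
    show "v ` I \<subseteq> carrier (?M\<lparr>carrier := V\<rparr>)" using vV by simp
    show "W.lin_indpt (v ` I)"
    proof (rule W.finite_lin_indpt2)
      fix a assume a: "a \<in> v ` I \<rightarrow> carrier R" and 0: "W.lincomb a (v ` I) = \<zero>\<^bsub>?M\<lparr>carrier := V\<rparr>\<^esub>"
      have ac: "a (v i) \<in> carrier R" if "i \<in> I" for i using a that by blast
      \<comment> \<open>The vanishing combination, read at the pivot \<open>i\<close>, isolates the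
        coefficient of \<open>v i\<close>.\<close>
      have "a (v i) = \<zero>" if i: "i \<in> I" for i
      proof -
        have "\<zero> = W.lincomb a (v ` I) i" using i I unfolding 0 by (auto simp: power_self_simps)
        also have "\<dots> = (\<Oplus>j\<in>I. a (v j) \<otimes> v j i)" using i I by (intro comb a) auto
        also have "\<dots> = (\<Oplus>j\<in>I. if i = j then a (v j) else \<zero>)"
          using b i ac by (intro finsum_cong') (auto simp: pivot_basis_def)
        also have "\<dots> = a (v i)" using i I a by (intro finsum_singleton) auto
        finally show ?thesis by simp
      qed
      then show "\<forall>x\<in>v ` I. a x = \<zero>" by blast
    qed (use I vV in auto)
    have "w \<in> W.span (v ` I)" if w: "w \<in> V" for w
    proof -
      \<comment> \<open>The coefficient of \<open>v i\<close> has to be \<open>w i\<close>; as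
        coefficients are functions of vectors, the index is recovered from the vector.\<close>
      define a where "a = (\<lambda>x. w (the_inv_into I v x))"
      have av: "a (v i) = w i" if "i \<in> I" for i using that inj by (simp add: a_def the_inv_into_f_f)
      have wc: "w l \<in> carrier R" if "l < n" for l using submodule_power_coord[OF V w that] .
      have a: "a \<in> v ` I \<rightarrow> carrier R" using av wc I by auto
      have "W.lincomb a (v ` I) \<in> V" using W.lincomb_closed[of "v ` I" a] vV a by simp
      moreover have "W.lincomb a (v ` I) l = w l" if l: "l < n" for l
      proof -
        have "W.lincomb a (v ` I) l = (\<Oplus>i\<in>I. w i \<otimes> v i l)"
          unfolding comb[OF a l] using av wc vc I l by (intro finsum_cong') auto
        then show ?thesis using pivot_basis_expansion[OF V b w l] by simp
      qed
      ultimately have "W.lincomb a (v ` I) = w"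
        using w VM by (intro PiE_ext[of _ "{..<n}" "\<lambda>_. carrier R"]) auto
      then show ?thesis unfolding W.span_def using a I by blast
    qed
    moreover have "W.span (v ` I) \<subseteq> V" using W.span_is_subset2[of "v ` I"] vV by simp
    ultimately show "W.gen_set (v ` I)" by auto
  qed
  then have "W.dim = card (v ` I)" using I by (intro W.dim_basis) auto
  then show ?thesis using inj by (simp add: card_image)
qed

section \<open>Integral bases over a valuation ring\<close>

text \<open>\<open>q\<close> is an element of least valuation, found by comparing each new
  \<open>x\<close> with the best element so far. If \<open>x \<otimes> inv q\<close> is not
  integral, then \<open>q \<otimes> inv x\<close> is, and \<open>x\<close> takes over: it divides
  \<open>q\<close>, which divides the rest.\<close>

lemma (in field) valuation_ring_divisor:
  assumes O: "valuation_ring \<O> R" and "finite S" "S \<subseteq> carrier R" "\<exists>x\<in>S. x \<noteq> \<zero>"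
  shows "\<exists>q\<in>S. q \<noteq> \<zero> \<and> (\<forall>x\<in>S. x \<otimes> inv q \<in> \<O>)"
  using assms(2-)
proof (induction S)
  case (insert x S)
  have sub: "subring \<O> R" using O by (simp add: valuation_ring_def)
  have inv: "inv y \<in> carrier R" "y \<otimes> inv y = \<one>" "inv y \<otimes> y = \<one>" if "y \<in> carrier R" "y \<noteq> \<zero>" for y
    using that by (auto simp: field_Units)
  have in_O: "y \<otimes> inv y \<in> \<O>" "\<zero> \<in> \<O>" if "y \<in> carrier R" "y \<noteq> \<zero>" for y
    using inv(2)[OF that] subringE(2,3)[OF sub] by auto
  show ?case
  proof (cases "\<exists>y\<in>S. y \<noteq> \<zero>")
    \<comment> \<open>All earlier elements vanish, so the nonzero one must be \<open>x\<close>.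
      Their quotients by \<open>x\<close> are zero, which is why \<open>in_O\<close> also records
      \<open>\<zero> \<in> \<O>\<close>.\<close>
    case False
    then show ?thesis using insert.prems in_O inv by (intro bexI[of _ x]) auto
  next
    case True
    then obtain q where q: "q \<in> S" "q \<noteq> \<zero>" "\<And>y. y \<in> S \<Longrightarrow> y \<otimes> inv q \<in> \<O>"
      using insert by auto
    have qx: "q \<in> carrier R" "x \<in> carrier R" using q insert.prems by auto
    note inv_q = inv[OF qx(1) q(2)]
    show ?thesis
    proof (cases "x \<otimes> inv q \<in> \<O>")
      case True
      then show ?thesis using q by blast
    next
      case False
      then have x0: "x \<noteq> \<zero>" using inv_q subringE(2)[OF sub] by auto
      note inv_x = inv[OF qx(2) x0]
      \<comment> \<open>The valuation property yields the inverse of the nonintegral quotient, which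
        is the opposite quotient.\<close>
      have "inv (x \<otimes> inv q) = q \<otimes> inv x"
      proof (rule comm_inv_char)
        have "(x \<otimes> inv q) \<otimes> (q \<otimes> inv x) = x \<otimes> (inv q \<otimes> q) \<otimes> inv x"
          using qx inv_q(1) inv_x(1) by (simp only: m_assoc m_closed)
        then show "(x \<otimes> inv q) \<otimes> (q \<otimes> inv x) = \<one>"
          using qx inv_q inv_x by simp
      qed (use qx inv_q inv_x in simp_all)
      moreover have "x \<otimes> inv q \<noteq> \<zero>"
        using x0 q(2) qx inv_q by (metis integral l_null one_not_zero)
      ultimately have qx': "q \<otimes> inv x \<in> \<O>"
        using O False qx inv_q unfolding valuation_ring_def by (metis m_closed)
      have "y \<otimes> inv x \<in> \<O>" if y: "y \<in> S" for y
      proof -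
        have yc: "y \<in> carrier R" using y insert.prems by auto
        have "(y \<otimes> inv q) \<otimes> (q \<otimes> inv x) = y \<otimes> (inv q \<otimes> q) \<otimes> inv x"
          using yc qx inv_q(1) inv_x(1) by (simp only: m_assoc m_closed)
        also have "\<dots> = y \<otimes> inv x" using yc inv_q by simp
        finally show ?thesis using subringE(6)[OF sub q(3)[OF y] qx'] by simp
      qed
      then show ?thesis using x0 in_O[OF qx(2) x0] by (intro bexI[of _ x]) auto
    qed
  qed
qed simp

text \<open>A maximal partial system of integral vectors normalised at a set of coordinates is a basis:
  a further vector, reduced against the system and divided by its coordinate of least valuation,
  would enlarge it.\<close>

lemma (in field) integral_pivot_basis_exists:
  assumes O: "valuation_ring \<O> R" and V: "Module.submodule V R (module_power n (self_module R))"
  shows "\<exists>I v. pivot_basis R n V I v \<and> (\<forall>i\<in>I. v i \<in> {..<n} \<rightarrow>\<^sub>E \<O>)"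
proof -
  have sub: "subring \<O> R" using O by (simp add: valuation_ring_def)
  have VM: "V \<subseteq> {..<n} \<rightarrow>\<^sub>E carrier R" using V unfolding submodule_power_iff by blast
  \<comment> \<open>This is \<open>pivot_basis\<close> with integrality added and the injectivity
    clause left out; maximality has to supply that clause. Only \<open>I\<close> is maximised, since
    it ranges over a finite set while the systems \<open>v\<close> need not.\<close>
  define Q where "Q = (\<lambda>I v. I \<subseteq> {..<n} \<and> (\<forall>i\<in>I. v i \<in> V \<inter> ({..<n} \<rightarrow>\<^sub>E \<O>)) \<and>
    (\<forall>i\<in>I. \<forall>j\<in>I. v i j = (if i = j then \<one> else \<zero>)))"
  have "finite {I. \<exists>v. Q I v}" by (rule finite_subset[of _ "Pow {..<n}"]) (auto simp: Q_def)
  moreover have "{} \<in> {I. \<exists>v. Q I v}" by (simp add: Q_def)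
  ultimately obtain I where I: "I \<in> {I. \<exists>v. Q I v}"
    and maxI: "\<And>J. J \<in> {I. \<exists>v. Q I v} \<Longrightarrow> I \<subseteq> J \<Longrightarrow> I = J"
    using finite_has_maximal[of "{I. \<exists>v. Q I v}"] by blast
  then obtain v where v: "Q I v" by blast
  have "w l = \<zero>" if w: "w \<in> V" "\<forall>i\<in>I. w i = \<zero>" and l: "l < n" for w l
  proof (rule ccontr)
    assume wl: "w l \<noteq> \<zero>"
    have wc: "w j \<in> carrier R" if "j < n" for j using submodule_power_coord[OF V w(1) that] .
    have "\<exists>q\<in>w ` {..<n}. q \<noteq> \<zero> \<and> (\<forall>x\<in>w ` {..<n}. x \<otimes> inv q \<in> \<O>)"
      using wl l wc by (intro valuation_ring_divisor[OF O]) auto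
    then obtain q where q: "q < n" "w q \<noteq> \<zero>" "\<And>j. j < n \<Longrightarrow> w j \<otimes> inv (w q) \<in> \<O>"
      by auto
    have wq: "inv (w q) \<in> carrier R" "inv (w q) \<otimes> w q = \<one>"
      using q wc by (auto simp: field_Units)
    define x where "x = (\<lambda>l\<in>{..<n}. inv (w q) \<otimes> w l)"
    have xV: "x \<in> V" using V w(1) wq unfolding x_def submodule_power_iff by blast
    have xO: "x \<in> {..<n} \<rightarrow>\<^sub>E \<O>" using q(3) wc wq by (auto simp: x_def m_comm)
    have xI: "x i = \<zero>" if "i \<in> I" for i using that w(2) v wq by (auto simp: x_def Q_def)
    have xq: "x q = \<one>" using q wq by (simp add: x_def)
    have qI: "q \<notin> I" using w(2) q by auto
    \<comment> \<open>The old vectors are cleared at the new pivot \<open>q\<close>. As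
      \<open>x\<close> vanishes on \<open>I\<close>, their old pivot entries are undisturbed, and as
      \<open>v i q\<close> is integral, they stay integral.\<close>
    define v' where "v' = (\<lambda>i. if i = q then x else (\<lambda>l\<in>{..<n}. \<one> \<otimes> v i l \<oplus> (\<ominus> v i q) \<otimes> x l))"
    have O: "\<O> \<subseteq> carrier R" using subringE(1)[OF sub] .
    have vO: "v i j \<in> \<O>" if "i \<in> I" "j < n" for i j
      using PiE_coord[of "v i" n \<O> j] v that by (simp add: Q_def)
    have "Q (insert q I) v'"
      unfolding Q_def
    proof (intro conjI ballI)
      show "insert q I \<subseteq> {..<n}" using q v by (auto simp: Q_def)
      fix i assume i: "i \<in> insert q I"
      show "v' i \<in> V \<inter> ({..<n} \<rightarrow>\<^sub>E \<O>)"
      proof (cases "i = q")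
        case True
        then show ?thesis using xV xO by (simp add: v'_def)
      next
        case False
        then have i': "i \<in> I" using i by simp
        have "v' i \<in> V"
          using False v i' xV vO[OF i' q(1)] O
          by (auto simp: v'_def Q_def intro!: submodule_power_lincomb2[OF V])
        moreover have "v' i \<in> {..<n} \<rightarrow>\<^sub>E \<O>"
          using False vO[OF i'] q(1) PiE_coord[OF xO]
          by (auto simp: v'_def intro!: subringE[OF sub])
        ultimately show ?thesis by simp
      qed
      fix j assume j: "j \<in> insert q I"
      then have jn: "j < n" using q v by (auto simp: Q_def)
      show "v' i j = (if i = j then \<one> else \<zero>)"
      proof (cases "i = q")
        case True
        then show ?thesis using j xI xq qI by (auto simp: v'_def)
      next
        case False
        then have i': "i \<in> I" using i by simp
        have c: "v i j \<in> carrier R" "v i q \<in> carrier R" using vO[OF i'] jn q(1) O by auto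
        show ?thesis
        proof (cases "j = q")
          case True
          then show ?thesis using False c xq q(1) by (simp add: v'_def r_neg)
        next
          case j': False
          then have "j \<in> I" using j by simp
          moreover from this have "v i j = (if i = j then \<one> else \<zero>)" using v i' by (simp add: Q_def)
          ultimately show ?thesis using False c xI jn by (simp add: v'_def)
        qed
      qed
    qed
    then have "I = insert q I" using maxI[of "insert q I"] by blast
    then show False using qI by blast
  qed
  then have "pivot_basis R n V I v \<and> (\<forall>i\<in>I. v i \<in> {..<n} \<rightarrow>\<^sub>E \<O>)"
    using v unfolding pivot_basis_def Q_def by blast
  then show ?thesis by blast
qed

section \<open>Matrices acting on vectors\<close>

definition mat_vec :: "('r, 'x) ring_scheme \<Rightarrow> nat \<Rightarrow> (nat \<Rightarrow> nat \<Rightarrow> 'r) \<Rightarrow> (nat \<Rightarrow> 'r) \<Rightarrow> nat \<Rightarrow> 'r" where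
  "mat_vec R n g v = (\<lambda>i\<in>{..<n}. \<Oplus>\<^bsub>R\<^esub>j\<in>{..<n}. g i j \<otimes>\<^bsub>R\<^esub> v j)"

lemma finsum_self_module: "finsum (self_module R) = finsum R"
  by (simp add: fun_eq_iff finsum_def finprod_def self_module_def)

lemma Dir_simps:
  "carrier (sort (Dir \<iota> R B) n) = {N. Module.submodule N R (module_power n B)}"
  "le (sort (Dir \<iota> R B) n) = (\<subseteq>)"
  "osum (Dir \<iota> R B) n m V W = {vec_append n m v w | v w. v \<in> V \<and> w \<in> W}"
  by (simp_all add: Dir_def Sub_def)

lemma weak_partial_order_Sub: "weak_partial_order (Sub R M)"
  by unfold_locales (auto simp: Sub_def)

text \<open>This brings the actions on source and target to one form. The structure map is the
  identity for \<open>K\<close> and the residue map for the residue field.\<close>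

lemma gl_act_Dir_self_module:
  "gl_act (Dir \<iota> R (self_module R)) n g V = mat_vec R n (\<lambda>i j. \<iota> (g i j)) ` V"
  by (simp add: Dir_def mat_vec_def finsum_self_module) (simp add: self_module_def)

text \<open>Matrix products in \<open>GL\<close> are formed in the base field, and the residue map
  starts from \<open>\<O>\<close>, while the vectors have entries in all of \<open>K\<close>. This
  reconciles the sums.\<close>

lemma (in ring) finsum_subring:
  assumes S: "subring S R" and f: "f \<in> A \<rightarrow> S"
  shows "(\<Oplus>\<^bsub>R\<lparr>carrier := S\<rparr>\<^esub>i\<in>A. f i) = (\<Oplus>i\<in>A. f i)" and "(\<Oplus>i\<in>A. f i) \<in> S"
proof -
  interpret S: ring "R\<lparr>carrier := S\<rparr>" by (rule subring_is_ring[OF S])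
  have SR: "S \<subseteq> carrier R" by (rule subringE(1)[OF S])
  have "(\<Oplus>\<^bsub>R\<lparr>carrier := S\<rparr>\<^esub>i\<in>A. f i) = (\<Oplus>i\<in>A. f i) \<and> (\<Oplus>i\<in>A. f i) \<in> S"
    using f
  proof (induction A rule: infinite_finite_induct)
    \<comment> \<open>A sum over an infinite index set is by definition zero, and the two rings
      share their zero.\<close>
    case (infinite A)
    then show ?case using subringE(2)[OF S] by (simp add: finsum_def finprod_def)
  next
    case empty
    then show ?case using subringE(2)[OF S] by (simp add: finsum_def finprod_def)
  next
    case (insert x A)
    then have "f \<in> A \<rightarrow> carrier R" "f x \<in> carrier R" "f \<in> A \<rightarrow> S" "f x \<in> S" using SR by auto
    then show ?case using insert subringE(7)[OF S]
      by (simp add: finsum_insert S.finsum_insert)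
  qed
  then show "(\<Oplus>\<^bsub>R\<lparr>carrier := S\<rparr>\<^esub>i\<in>A. f i) = (\<Oplus>i\<in>A. f i)" "(\<Oplus>i\<in>A. f i) \<in> S" by auto
qed

lemma (in abelian_monoid) finsum_swap:
  assumes "finite A" "finite B" "\<And>i j. i \<in> A \<Longrightarrow> j \<in> B \<Longrightarrow> f i j \<in> carrier G"
  shows "(\<Oplus>i\<in>A. \<Oplus>j\<in>B. f i j) = (\<Oplus>j\<in>B. \<Oplus>i\<in>A. f i j)"
  using assms(1,3)
proof (induction A)
  case (insert x A)
  have "(\<lambda>i. \<Oplus>j\<in>B. f i j) \<in> A \<rightarrow> carrier G" "(\<Oplus>j\<in>B. f x j) \<in> carrier G"
    using insert.prems by (auto intro!: finsum_closed)
  then have "(\<Oplus>i\<in>insert x A. \<Oplus>j\<in>B. f i j) = (\<Oplus>j\<in>B. f x j) \<oplus> (\<Oplus>j\<in>B. \<Oplus>i\<in>A. f i j)"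
    using insert by (simp add: finsum_insert)
  also have "\<dots> = (\<Oplus>j\<in>B. f x j \<oplus> (\<Oplus>i\<in>A. f i j))"
    using insert.prems by (intro finsum_addf[symmetric]) (auto intro!: finsum_closed)
  also have "\<dots> = (\<Oplus>j\<in>B. \<Oplus>i\<in>insert x A. f i j)"
    using insert by (intro finsum_cong') (auto simp: finsum_insert Pi_def intro!: finsum_closed)
  finally show ?case .
qed simp

lemma (in cring) mat_vec_mat_vec:
  assumes g: "\<And>i j. i < n \<Longrightarrow> j < n \<Longrightarrow> g i j \<in> carrier R"
    and h: "\<And>i j. i < n \<Longrightarrow> j < n \<Longrightarrow> h i j \<in> carrier R"
    and v: "v \<in> {..<n} \<rightarrow>\<^sub>E carrier R"
  shows "mat_vec R n h (mat_vec R n g v) = mat_vec R n (mat_mult R n h g) v"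
proof -
  have vc: "v i \<in> carrier R" if "i < n" for i using v that by (rule PiE_coord)
  have "(\<Oplus>j\<in>{..<n}. h i j \<otimes> mat_vec R n g v j) = (\<Oplus>l\<in>{..<n}. mat_mult R n h g i l \<otimes> v l)"
    if i: "i < n" for i
  proof -
    have "(\<Oplus>j\<in>{..<n}. h i j \<otimes> mat_vec R n g v j)
        = (\<Oplus>j\<in>{..<n}. \<Oplus>l\<in>{..<n}. h i j \<otimes> (g j l \<otimes> v l))"
      using g h vc i
      by (intro finsum_cong') (auto simp: mat_vec_def Pi_def finsum_rdistr intro!: finsum_closed)
    also have "\<dots> = (\<Oplus>l\<in>{..<n}. \<Oplus>j\<in>{..<n}. h i j \<otimes> (g j l \<otimes> v l))"
      using g h vc i by (intro finsum_swap) auto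
    also have "\<dots> = (\<Oplus>l\<in>{..<n}. \<Oplus>j\<in>{..<n}. (h i j \<otimes> g j l) \<otimes> v l)"
      using g h vc i by (intro finsum_cong') (auto simp: m_assoc Pi_def intro!: finsum_closed)
    also have "\<dots> = (\<Oplus>l\<in>{..<n}. mat_mult R n h g i l \<otimes> v l)"
      using g h vc i
      by (intro finsum_cong') (auto simp: mat_mult_def Pi_def finsum_ldistr intro!: finsum_closed)
    finally show ?thesis .
  qed
  then show ?thesis unfolding mat_vec_def[of R n h] mat_vec_def[of R n "mat_mult R n h g"]
    by (intro restrict_ext) simp
qed

lemma (in cring) mat_vec_one:
  assumes v: "v \<in> {..<n} \<rightarrow>\<^sub>E carrier R"
  shows "mat_vec R n (mat_one R n) v = v"
proof -
  have vc: "v i \<in> carrier R" if "i < n" for i using v that by (rule PiE_coord)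
  have "(\<Oplus>j\<in>{..<n}. mat_one R n i j \<otimes> v j) = v i" if i: "i < n" for i
  proof -
    have "(\<Oplus>j\<in>{..<n}. mat_one R n i j \<otimes> v j) = (\<Oplus>j\<in>{..<n}. if i = j then v j else \<zero>)"
      using vc i by (intro finsum_cong') (auto simp: mat_one_def)
    also have "\<dots> = v i" using vc i by (intro finsum_singleton) auto
    finally show ?thesis .
  qed
  then have "mat_vec R n (mat_one R n) v i = v i" if "i < n" for i
    using that by (simp add: mat_vec_def)
  moreover have "mat_vec R n (mat_one R n) v \<in> extensional {..<n}" by (simp add: mat_vec_def)
  ultimately show ?thesis using v by (intro extensionalityI[of _ "{..<n}"]) (auto simp: PiE_iff)
qed

text \<open>The inverse provided by \<open>GL\<close> refers to products formed in \<open>S\<close>.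
  Since sums in \<open>S\<close> and \<open>R\<close> agree, the same matrix undoes the action on
  all vectors over \<open>R\<close>, including those with entries outside \<open>S\<close>.\<close>

lemma (in cring) GL_subring_left_inverse:
  assumes S: "subring S R" and g: "g \<in> GL n (R\<lparr>carrier := S\<rparr>)"
  obtains h where "\<And>i j. i < n \<Longrightarrow> j < n \<Longrightarrow> h i j \<in> S"
    "\<And>v. v \<in> {..<n} \<rightarrow>\<^sub>E carrier R \<Longrightarrow> mat_vec R n h (mat_vec R n g v) = v"
proof -
  obtain h where h: "h \<in> {..<n} \<rightarrow>\<^sub>E {..<n} \<rightarrow>\<^sub>E S"
    and hg: "mat_mult (R\<lparr>carrier := S\<rparr>) n h g = mat_one (R\<lparr>carrier := S\<rparr>) n"
    using g by (auto simp: GL_def)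
  have gS: "g i j \<in> S" if "i < n" "j < n" for i j using g that by (auto simp: GL_def PiE_iff)
  have hS: "h i j \<in> S" if "i < n" "j < n" for i j using h that by (auto simp: PiE_iff)
  have SR: "S \<subseteq> carrier R" by (rule subringE(1)[OF S])
  have "mat_mult (R\<lparr>carrier := S\<rparr>) n h g = mat_mult R n h g"
    unfolding mat_mult_def
  proof (intro restrict_ext)
    fix i j assume "i \<in> {..<n}" "j \<in> {..<n}"
    then have "(\<lambda>l. h i l \<otimes> g l j) \<in> {..<n} \<rightarrow> S" using gS hS subringE(6)[OF S] by auto
    then show "(\<Oplus>\<^bsub>R\<lparr>carrier := S\<rparr>\<^esub>l\<in>{..<n}. h i l \<otimes>\<^bsub>R\<lparr>carrier := S\<rparr>\<^esub> g l j) = (\<Oplus>l\<in>{..<n}. h i l \<otimes> g l j)"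
      using finsum_subring(1)[OF S] by simp
  qed
  moreover have "mat_one (R\<lparr>carrier := S\<rparr>) n = mat_one R n" by (simp add: mat_one_def cong: if_cong)
  ultimately have hg': "mat_mult R n h g = mat_one R n" using hg by simp
  have "mat_vec R n h (mat_vec R n g v) = v" if v: "v \<in> {..<n} \<rightarrow>\<^sub>E carrier R" for v
  proof -
    have "mat_vec R n h (mat_vec R n g v) = mat_vec R n (mat_mult R n h g) v"
      using gS hS SR by (intro mat_vec_mat_vec v) auto
    then show ?thesis using hg' mat_vec_one[OF v] by simp
  qed
  then show thesis using hS that by blast
qed

section \<open>Specialization\<close>

locale residue_map = field K for K :: "('a, 'x) ring_scheme" (structure) +
  fixes \<O> \<mm> :: "'a set"
  assumes valuation: "valuation_ring \<O> K" and maximal: "maximalideal \<mm> (K\<lparr>carrier := \<O>\<rparr>)"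
begin

abbreviation k where "k \<equiv> residue_field K \<O> \<mm>"
abbreviation res where "res \<equiv> residue K \<O> \<mm>"

definition red :: "nat \<Rightarrow> (nat \<Rightarrow> 'a) \<Rightarrow> nat \<Rightarrow> 'a set" where
  "red n v = (\<lambda>i\<in>{..<n}. res (v i))"

section \<open>The residue map\<close>

lemma subring_O: "subring \<O> K"
  using valuation by (simp add: valuation_ring_def)

lemma O_carrier: "\<O> \<subseteq> carrier K"
  by (rule subringE(1)[OF subring_O])

lemma cring_O: "cring (K\<lparr>carrier := \<O>\<rparr>)"
  using subcringI'[OF subring_O] subcring_iff[OF O_carrier] by simp

lemma ideal_m: "ideal \<mm> (K\<lparr>carrier := \<O>\<rparr>)"
  using maximal by (simp add: maximalideal_def)

lemma m_subset: "\<mm> \<subseteq> \<O>"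
  using additive_subgroup.a_subset[OF ideal.axioms(1)[OF ideal_m]] by simp

lemma field_k: "field k"
  unfolding residue_field_def by (rule maximalideal.quotient_is_field[OF maximal cring_O])

lemma res_hom: "res \<in> ring_hom (K\<lparr>carrier := \<O>\<rparr>) k"
  using ideal.rcos_ring_hom[OF ideal_m] unfolding residue_def[abs_def] residue_field_def .

lemma res_closed: "a \<in> \<O> \<Longrightarrow> res a \<in> carrier k"
  and res_add: "a \<in> \<O> \<Longrightarrow> b \<in> \<O> \<Longrightarrow> res (a \<oplus> b) = res a \<oplus>\<^bsub>k\<^esub> res b"
  and res_mult: "a \<in> \<O> \<Longrightarrow> b \<in> \<O> \<Longrightarrow> res (a \<otimes> b) = res a \<otimes>\<^bsub>k\<^esub> res b"
  and res_one: "res \<one> = \<one>\<^bsub>k\<^esub>"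
  using res_hom by (auto simp: ring_hom_def)

lemma res_zero_iff: "a \<in> \<O> \<Longrightarrow> res a = \<zero>\<^bsub>k\<^esub> \<longleftrightarrow> a \<in> \<mm>"
proof -
  interpret I: ideal \<mm> "K\<lparr>carrier := \<O>\<rparr>" by (rule ideal_m)
  assume "a \<in> \<O>"
  then show ?thesis
    using I.a_rcos_const I.a_rcos_self by (force simp: residue_def residue_field_def FactRing_def)
qed

lemma zero_m: "\<zero> \<in> \<mm>"
  using additive_subgroup.zero_closed[OF ideal.axioms(1)[OF ideal_m]] by simp

lemma res_zero: "res \<zero> = \<zero>\<^bsub>k\<^esub>"
  using res_zero_iff zero_m subringE(2)[OF subring_O] by simp

lemma res_surj: "x \<in> carrier k \<Longrightarrow> \<exists>a\<in>\<O>. x = res a"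
  by (auto simp: residue_field_def FactRing_def A_RCOSETS_def' residue_def)

lemma res_finsum:
  assumes "f \<in> A \<rightarrow> \<O>"
  shows "res (\<Oplus>i\<in>A. f i) = (\<Oplus>\<^bsub>k\<^esub>i\<in>A. res (f i))"
proof -
  interpret k: field k by (rule field_k)
  interpret h: ring_hom_cring "K\<lparr>carrier := \<O>\<rparr>" k res
    by (intro ring_hom_cring.intro cring_O k.is_cring ring_hom_cring_axioms.intro res_hom)
  have "res (\<Oplus>\<^bsub>K\<lparr>carrier := \<O>\<rparr>\<^esub>i\<in>A. f i) = (\<Oplus>\<^bsub>k\<^esub>i\<in>A. (res \<circ> f) i)"
    using assms by (intro h.hom_finsum) simp
  then show ?thesis using finsum_subring(1)[OF subring_O assms] by simp
qed

section \<open>The specialization of a subspace and its dimension\<close>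

lemma specialization_eq:
  assumes V: "V \<subseteq> {..<n} \<rightarrow>\<^sub>E carrier K"
  shows "specialization K \<O> \<mm> n V = red n ` (V \<inter> ({..<n} \<rightarrow>\<^sub>E \<O>))"
proof -
  interpret k: field k by (rule field_k)
  let ?add = "\<lambda>v w. \<lambda>i\<in>{..<n}. v i \<oplus> w i"
  \<comment> \<open>Vectors over \<open>\<mm>\<close> reduce to zero, so the summand
    \<open>\<mm>\<^sup>n\<close> of the definition leaves no trace after reduction.\<close>
  have eq: "red n (?add v w) = red n v" if "v \<in> {..<n} \<rightarrow>\<^sub>E \<O>" "w \<in> {..<n} \<rightarrow>\<^sub>E \<mm>" for v w
    unfolding red_def
  proof (rule restrict_ext)
    fix i assume "i \<in> {..<n}"
    moreover from this have "v i \<in> \<O>" "w i \<in> \<mm>"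
      using PiE_coord[OF that(1)] PiE_coord[OF that(2)] by auto
    moreover from this have "w i \<in> \<O>" "res (w i) = \<zero>\<^bsub>k\<^esub>" using m_subset res_zero_iff by auto
    ultimately show "res (?add v w i) = res (v i)" by (simp add: res_add res_closed)
  qed
  have "specialization K \<O> \<mm> n V
      = (\<Union>v\<in>V \<inter> ({..<n} \<rightarrow>\<^sub>E \<O>). \<Union>w\<in>{..<n} \<rightarrow>\<^sub>E \<mm>. {red n (?add v w)})"
    unfolding specialization_def set_add_def set_mult_def red_def[symmetric]
    by (simp add: power_self_simps image_UN)
  also have "\<dots> = (\<Union>v\<in>V \<inter> ({..<n} \<rightarrow>\<^sub>E \<O>). \<Union>w\<in>{..<n} \<rightarrow>\<^sub>E \<mm>. {red n v})"
    using eq by (intro SUP_cong refl) auto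
  also have "\<dots> = red n ` (V \<inter> ({..<n} \<rightarrow>\<^sub>E \<O>))"
  proof -
    \<comment> \<open>The inner union is constant in \<open>w\<close>, so it collapses once its
      index set is known to be nonempty.\<close>
    have "(\<lambda>i\<in>{..<n}. \<zero>) \<in> {..<n} \<rightarrow>\<^sub>E \<mm>" using zero_m by auto
    then have "({..<n} \<rightarrow>\<^sub>E \<mm>) \<noteq> {}" by blast
    then show ?thesis by auto
  qed
  finally show ?thesis .
qed

text \<open>The integral vectors of \<open>V\<close> are closed under scalars from
  \<open>\<O>\<close>, and every scalar of the residue field lifts to \<open>\<O>\<close>.\<close>

lemma submodule_specialization:
  assumes V: "Module.submodule V K (module_power n (self_module K))"
  shows "Module.submodule (specialization K \<O> \<mm> n V) k (module_power n (self_module k))"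
proof -
  interpret k: field k by (rule field_k)
  have VM: "V \<subseteq> {..<n} \<rightarrow>\<^sub>E carrier K" using V unfolding submodule_power_iff by blast
  let ?W = "V \<inter> ({..<n} \<rightarrow>\<^sub>E \<O>)"
  have coord: "v i \<in> \<O>" if "v \<in> ?W" "i < n" for v i using that PiE_coord by blast
  have 0: "(\<lambda>i\<in>{..<n}. \<zero>) \<in> ?W"
    using V subringE(2)[OF subring_O] unfolding submodule_power_iff by auto
  have add: "(\<lambda>i\<in>{..<n}. v i \<oplus> w i) \<in> ?W" if "v \<in> ?W" "w \<in> ?W" for v w
  proof -
    have "(\<lambda>i\<in>{..<n}. v i \<oplus> w i) \<in> V" using V that unfolding submodule_power_iff by blast
    moreover have "(\<lambda>i\<in>{..<n}. v i \<oplus> w i) \<in> {..<n} \<rightarrow>\<^sub>E \<O>"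
      using coord[OF that(1)] coord[OF that(2)] subringE(7)[OF subring_O] by auto
    ultimately show ?thesis by blast
  qed
  have smult: "(\<lambda>i\<in>{..<n}. a \<otimes> v i) \<in> ?W" if "v \<in> ?W" "a \<in> \<O>" for a v
  proof -
    have "(\<lambda>i\<in>{..<n}. a \<otimes> v i) \<in> V" using V that O_carrier unfolding submodule_power_iff by blast
    moreover have "(\<lambda>i\<in>{..<n}. a \<otimes> v i) \<in> {..<n} \<rightarrow>\<^sub>E \<O>"
      using coord[OF that(1)] that(2) subringE(6)[OF subring_O] by auto
    ultimately show ?thesis by blast
  qed
  show ?thesis
    unfolding k.submodule_power_iff specialization_eq[OF VM]
  proof (intro conjI ballI)
    show "red n ` ?W \<subseteq> {..<n} \<rightarrow>\<^sub>E carrier k"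
      using coord res_closed by (auto simp: red_def)
    have "red n (\<lambda>i\<in>{..<n}. \<zero>) = (\<lambda>i\<in>{..<n}. \<zero>\<^bsub>k\<^esub>)"
      unfolding red_def by (rule restrict_ext) (simp add: res_zero)
    then show "(\<lambda>i\<in>{..<n}. \<zero>\<^bsub>k\<^esub>) \<in> red n ` ?W" using imageI[OF 0, of "red n"] by (simp only:)
  next
    fix x y assume "x \<in> red n ` ?W" "y \<in> red n ` ?W"
    then obtain v w where vw: "v \<in> ?W" "w \<in> ?W" "x = red n v" "y = red n w" by blast
    have "red n (\<lambda>i\<in>{..<n}. v i \<oplus> w i) = (\<lambda>i\<in>{..<n}. x i \<oplus>\<^bsub>k\<^esub> y i)"
      unfolding red_def
    proof (rule restrict_ext)
      fix i assume "i \<in> {..<n}"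
      moreover from this have "v i \<in> \<O>" "w i \<in> \<O>" using coord vw by auto
      ultimately show "res ((\<lambda>i\<in>{..<n}. v i \<oplus> w i) i) = x i \<oplus>\<^bsub>k\<^esub> y i"
        by (simp add: vw(3,4) red_def res_add)
    qed
    then show "(\<lambda>i\<in>{..<n}. x i \<oplus>\<^bsub>k\<^esub> y i) \<in> red n ` ?W"
      using imageI[OF add[OF vw(1,2)], of "red n"] by (simp only:)
  next
    fix r x assume "r \<in> carrier k" "x \<in> red n ` ?W"
    then obtain a v where av: "a \<in> \<O>" "v \<in> ?W" "r = res a" "x = red n v" using res_surj by blast
    have "red n (\<lambda>i\<in>{..<n}. a \<otimes> v i) = (\<lambda>i\<in>{..<n}. r \<otimes>\<^bsub>k\<^esub> x i)"
      unfolding red_def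
    proof (rule restrict_ext)
      fix i assume "i \<in> {..<n}"
      moreover from this have "v i \<in> \<O>" using coord av by auto
      ultimately show "res ((\<lambda>i\<in>{..<n}. a \<otimes> v i) i) = r \<otimes>\<^bsub>k\<^esub> x i"
        using av(1) by (simp add: av(3,4) red_def res_mult)
    qed
    then show "(\<lambda>i\<in>{..<n}. r \<otimes>\<^bsub>k\<^esub> x i) \<in> red n ` ?W"
      using imageI[OF smult[OF av(2,1)], of "red n"] by (simp only:)
  qed
qed

text \<open>Zeros and ones at the pivots survive reduction. For injectivity, expand an integral
  \<open>w\<close> whose pivot coordinates lie in \<open>\<mm>\<close>: each term is such a
  coordinate times an integral entry, so every coordinate of \<open>w\<close> reduces to
  zero.\<close>

lemma pivot_basis_specialization:
  assumes V: "Module.submodule V K (module_power n (self_module K))"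
    and b: "pivot_basis K n V I v" and vO: "\<And>i. i \<in> I \<Longrightarrow> v i \<in> {..<n} \<rightarrow>\<^sub>E \<O>"
  shows "pivot_basis k n (specialization K \<O> \<mm> n V) I (\<lambda>i. red n (v i))"
proof -
  interpret k: field k by (rule field_k)
  interpret m: ideal \<mm> "K\<lparr>carrier := \<O>\<rparr>" by (rule ideal_m)
  have VM: "V \<subseteq> {..<n} \<rightarrow>\<^sub>E carrier K" using V unfolding submodule_power_iff by blast
  have I: "I \<subseteq> {..<n}" using b by (simp add: pivot_basis_def)
  have vanish: "res (w l) = \<zero>\<^bsub>k\<^esub>"
    if w: "w \<in> V" "w \<in> {..<n} \<rightarrow>\<^sub>E \<O>" and 0: "\<And>i. i \<in> I \<Longrightarrow> res (w i) = \<zero>\<^bsub>k\<^esub>" and l: "l < n" for w l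
  proof -
    have wI: "w i \<in> \<O>" "v i l \<in> \<O>" if "i \<in> I" for i
      using that I PiE_coord[OF w(2), of i] PiE_coord[OF vO l] by auto
    have "res (w l) = res (\<Oplus>i\<in>I. w i \<otimes> v i l)"
      using pivot_basis_expansion[OF V b w(1) l] by simp
    also have "\<dots> = (\<Oplus>\<^bsub>k\<^esub>i\<in>I. res (w i \<otimes> v i l))"
      using wI subringE(6)[OF subring_O] by (intro res_finsum) auto
    also have "\<dots> = (\<Oplus>\<^bsub>k\<^esub>i\<in>I. \<zero>\<^bsub>k\<^esub>)"
      using wI 0 by (intro k.finsum_cong') (auto simp: res_mult res_closed)
    also have "\<dots> = \<zero>\<^bsub>k\<^esub>" by (rule k.finsum_zero)
    finally show ?thesis .
  qed
  show ?thesis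
    unfolding pivot_basis_def specialization_eq[OF VM]
  proof (intro conjI ballI impI allI I)
    fix i assume "i \<in> I"
    then show "red n (v i) \<in> red n ` (V \<inter> ({..<n} \<rightarrow>\<^sub>E \<O>))"
      using b vO by (auto simp: pivot_basis_def)
  next
    fix i j assume "i \<in> I" "j \<in> I"
    moreover from this have "v i j = (if i = j then \<one> else \<zero>)" using b by (simp add: pivot_basis_def)
    ultimately show "red n (v i) j = (if i = j then \<one>\<^bsub>k\<^esub> else \<zero>\<^bsub>k\<^esub>)"
      using I by (auto simp: red_def res_one res_zero)
  next
    fix x l assume x: "x \<in> red n ` (V \<inter> ({..<n} \<rightarrow>\<^sub>E \<O>))" "\<forall>i\<in>I. x i = \<zero>\<^bsub>k\<^esub>" and l: "l < n"
    then obtain w where w: "w \<in> V" "w \<in> {..<n} \<rightarrow>\<^sub>E \<O>" "x = red n w" by blast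
    have "res (w i) = \<zero>\<^bsub>k\<^esub>" if i: "i \<in> I" for i
    proof -
      have "x i = res (w i)" using i I w(3) by (auto simp: red_def)
      then show ?thesis using x(2) i by simp
    qed
    then show "x l = \<zero>\<^bsub>k\<^esub>" using vanish[OF w(1,2) _ l] w(3) l by (simp add: red_def)
  qed
qed

lemma length_specialization:
  assumes V: "Module.submodule V K (module_power n (self_module K))"
  shows "module_length k ((module_power n (self_module k))\<lparr>carrier := specialization K \<O> \<mm> n V\<rparr>)
    = enat (vectorspace.dim K ((module_power n (self_module K))\<lparr>carrier := V\<rparr>))"
proof -
  interpret k: field k by (rule field_k)
  obtain I v where b: "pivot_basis K n V I v" "\<forall>i\<in>I. v i \<in> {..<n} \<rightarrow>\<^sub>E \<O>"
    using integral_pivot_basis_exists[OF valuation V] by blast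
  show ?thesis
    using k.module_length_pivot_basis[OF submodule_specialization[OF V] pivot_basis_specialization[OF V b(1)]]
      b(2) dim_pivot_basis[OF V b(1)] by simp
qed

section \<open>Equivariance under matrices over the base field\<close>

lemma mat_vec_integral:
  assumes g: "\<And>i j. i < n \<Longrightarrow> j < n \<Longrightarrow> g i j \<in> \<O>" and v: "v \<in> {..<n} \<rightarrow>\<^sub>E \<O>"
  shows "mat_vec K n g v \<in> {..<n} \<rightarrow>\<^sub>E \<O>"
    and "red n (mat_vec K n g v) = mat_vec k n (\<lambda>i j. res (g i j)) (red n v)"
proof -
  interpret k: field k by (rule field_k)
  have vO: "v i \<in> \<O>" if "i < n" for i using v that by (rule PiE_coord)
  have gv: "(\<lambda>j. g i j \<otimes> v j) \<in> {..<n} \<rightarrow> \<O>" if "i < n" for i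
    using g vO that subringE(6)[OF subring_O] by auto
  show "mat_vec K n g v \<in> {..<n} \<rightarrow>\<^sub>E \<O>"
    using finsum_subring(2)[OF subring_O gv] by (simp add: mat_vec_def)
  show "red n (mat_vec K n g v) = mat_vec k n (\<lambda>i j. res (g i j)) (red n v)"
    unfolding red_def[of n "mat_vec K n g v"] mat_vec_def[of k]
  proof (rule restrict_ext)
    fix i assume i: "i \<in> {..<n}"
    then have "res (mat_vec K n g v i) = (\<Oplus>\<^bsub>k\<^esub>j\<in>{..<n}. res (g i j \<otimes> v j))"
      using res_finsum[OF gv] by (simp add: mat_vec_def)
    also have "\<dots> = (\<Oplus>\<^bsub>k\<^esub>j\<in>{..<n}. res (g i j) \<otimes>\<^bsub>k\<^esub> red n v j)"
      using i g vO by (intro k.finsum_cong') (auto simp: red_def res_mult res_closed)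
    finally show "res (mat_vec K n g v i) = (\<Oplus>\<^bsub>k\<^esub>j\<in>{..<n}. res (g i j) \<otimes>\<^bsub>k\<^esub> red n v j)" .
  qed
qed

lemma specialization_mat_vec:
  assumes S: "subring S K" "S \<subseteq> \<O>" and g: "g \<in> GL n (K\<lparr>carrier := S\<rparr>)"
    and V: "V \<subseteq> {..<n} \<rightarrow>\<^sub>E carrier K"
  shows "specialization K \<O> \<mm> n (mat_vec K n g ` V)
    = mat_vec k n (\<lambda>i j. res (g i j)) ` specialization K \<O> \<mm> n V"
proof -
  have gO: "g i j \<in> \<O>" if "i < n" "j < n" for i j
    using g that S(2) by (auto simp: GL_def PiE_iff)
  obtain h where h: "\<And>i j. i < n \<Longrightarrow> j < n \<Longrightarrow> h i j \<in> S"
    "\<And>v. v \<in> {..<n} \<rightarrow>\<^sub>E carrier K \<Longrightarrow> mat_vec K n h (mat_vec K n g v) = v"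
    using GL_subring_left_inverse[OF S(1) g] by metis
  have hO: "h i j \<in> \<O>" if "i < n" "j < n" for i j using h(1)[OF that] S(2) by blast
  have "mat_vec K n g v \<in> {..<n} \<rightarrow>\<^sub>E carrier K" if "v \<in> V" for v
  proof -
    have "v j \<in> carrier K" if "j < n" for j
      using PiE_coord[OF subsetD[OF V \<open>v \<in> V\<close>] that] .
    then show ?thesis using gO O_carrier by (auto simp: mat_vec_def intro!: finsum_closed m_closed)
  qed
  then have gV: "mat_vec K n g ` V \<subseteq> {..<n} \<rightarrow>\<^sub>E carrier K" by blast
  \<comment> \<open>A priori an integral image could come from a nonintegral \<open>v\<close>.
    Applying \<open>h\<close>, whose entries are integral, to the image recovers \<open>v\<close>
    and excludes this.\<close>
  have "mat_vec K n g ` V \<inter> ({..<n} \<rightarrow>\<^sub>E \<O>) = mat_vec K n g ` (V \<inter> ({..<n} \<rightarrow>\<^sub>E \<O>))"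
  proof (intro equalityI subsetI)
    fix x assume "x \<in> mat_vec K n g ` V \<inter> ({..<n} \<rightarrow>\<^sub>E \<O>)"
    then obtain v where v: "v \<in> V" "x = mat_vec K n g v" "x \<in> {..<n} \<rightarrow>\<^sub>E \<O>" by blast
    then have "v = mat_vec K n h x" using h(2) V by auto
    then have "v \<in> {..<n} \<rightarrow>\<^sub>E \<O>" using mat_vec_integral(1)[OF hO v(3)] by simp
    then show "x \<in> mat_vec K n g ` (V \<inter> ({..<n} \<rightarrow>\<^sub>E \<O>))" using v by blast
  next
    fix x assume "x \<in> mat_vec K n g ` (V \<inter> ({..<n} \<rightarrow>\<^sub>E \<O>))"
    then obtain v where v: "v \<in> V" "v \<in> {..<n} \<rightarrow>\<^sub>E \<O>" "x = mat_vec K n g v" by blast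
    then show "x \<in> mat_vec K n g ` V \<inter> ({..<n} \<rightarrow>\<^sub>E \<O>)"
      using mat_vec_integral(1)[OF gO v(2)] by simp
  qed
  then show ?thesis
    unfolding specialization_eq[OF gV] specialization_eq[OF V]
    using mat_vec_integral(2)[OF gO] by (auto simp: image_image intro!: image_cong)
qed

section \<open>Compatibility with direct sums\<close>

lemma vec_append_mem_iff:
  "vec_append n m v w \<in> {..<n + m} \<rightarrow>\<^sub>E A \<longleftrightarrow> (\<forall>i<n. v i \<in> A) \<and> (\<forall>i<m. w i \<in> A)"
proof
  assume *: "vec_append n m v w \<in> {..<n + m} \<rightarrow>\<^sub>E A"
  have "v i \<in> A" if "i < n" for i
    using PiE_coord[OF *, of i] that by (simp add: vec_append_def)
  moreover have "w i \<in> A" if "i < m" for i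
    using PiE_coord[OF *, of "n + i"] that by (simp add: vec_append_def)
  ultimately show "(\<forall>i<n. v i \<in> A) \<and> (\<forall>i<m. w i \<in> A)" by blast
qed (auto simp: vec_append_def)

text \<open>Integrality and reduction are both decided coordinate by coordinate, so both pass
  through the concatenation of vectors.\<close>

lemma specialization_osum:
  assumes V: "V \<subseteq> {..<n} \<rightarrow>\<^sub>E carrier K" and W: "W \<subseteq> {..<m} \<rightarrow>\<^sub>E carrier K"
  shows "specialization K \<O> \<mm> (n + m) {vec_append n m v w | v w. v \<in> V \<and> w \<in> W}
    = {vec_append n m x y | x y. x \<in> specialization K \<O> \<mm> n V \<and> y \<in> specialization K \<O> \<mm> m W}"
proof -
  have red_append: "red (n + m) (vec_append n m v w) = vec_append n m (red n v) (red m w)" for v w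
    by (rule ext) (auto simp: red_def vec_append_def)
  have vc: "v i \<in> carrier K" if "v \<in> V" "i < n" for v i using PiE_coord[OF subsetD[OF V]] that .
  have wc: "w i \<in> carrier K" if "w \<in> W" "i < m" for w i using PiE_coord[OF subsetD[OF W]] that .
  have VW: "{vec_append n m v w | v w. v \<in> V \<and> w \<in> W} \<subseteq> {..<n + m} \<rightarrow>\<^sub>E carrier K"
  proof
    fix x assume "x \<in> {vec_append n m v w | v w. v \<in> V \<and> w \<in> W}"
    then obtain v w where "x = vec_append n m v w" "v \<in> V" "w \<in> W" by blast
    then show "x \<in> {..<n + m} \<rightarrow>\<^sub>E carrier K" using vc wc by (simp only: vec_append_mem_iff) blast
  qed
  note eq = specialization_eq[OF VW] specialization_eq[OF V] specialization_eq[OF W]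
  have O: "vec_append n m v w \<in> {..<n + m} \<rightarrow>\<^sub>E \<O> \<longleftrightarrow>
      v \<in> {..<n} \<rightarrow>\<^sub>E \<O> \<and> w \<in> {..<m} \<rightarrow>\<^sub>E \<O>" if "v \<in> V" "w \<in> W" for v w
  proof -
    \<comment> \<open>\<open>vec_append\<close> reads only the entries in range. Membership of
      \<open>v\<close> and \<open>w\<close> in the function spaces also needs extensionality, which
      \<open>V\<close> and \<open>W\<close> provide.\<close>
    have "v \<in> extensional {..<n}" "w \<in> extensional {..<m}"
      using subsetD[OF V that(1)] subsetD[OF W that(2)] by (simp_all add: PiE_def)
    then show ?thesis unfolding vec_append_mem_iff by (auto simp: PiE_def)
  qed
  show ?thesis
    unfolding eq
  proof (intro equalityI subsetI)
    fix x assume "x \<in> red (n + m) ` ({vec_append n m v w | v w. v \<in> V \<and> w \<in> W} \<inter> ({..<n + m} \<rightarrow>\<^sub>E \<O>))"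
    then obtain v w where vw: "v \<in> V" "w \<in> W" "vec_append n m v w \<in> {..<n + m} \<rightarrow>\<^sub>E \<O>"
      "x = red (n + m) (vec_append n m v w)" by blast
    then have "red n v \<in> red n ` (V \<inter> ({..<n} \<rightarrow>\<^sub>E \<O>))" "red m w \<in> red m ` (W \<inter> ({..<m} \<rightarrow>\<^sub>E \<O>))"
      using O by blast+
    then show "x \<in> {vec_append n m x y | x y.
        x \<in> red n ` (V \<inter> ({..<n} \<rightarrow>\<^sub>E \<O>)) \<and> y \<in> red m ` (W \<inter> ({..<m} \<rightarrow>\<^sub>E \<O>))}"
      unfolding vw(4) red_append by blast
  next
    fix x assume "x \<in> {vec_append n m x y | x y.
        x \<in> red n ` (V \<inter> ({..<n} \<rightarrow>\<^sub>E \<O>)) \<and> y \<in> red m ` (W \<inter> ({..<m} \<rightarrow>\<^sub>E \<O>))}"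
    then obtain v w where vw: "v \<in> V" "w \<in> W" "v \<in> {..<n} \<rightarrow>\<^sub>E \<O>" "w \<in> {..<m} \<rightarrow>\<^sub>E \<O>"
      "x = vec_append n m (red n v) (red m w)" by blast
    have "vec_append n m v w \<in> {vec_append n m v w | v w. v \<in> V \<and> w \<in> W}"
      using vw(1,2) by blast
    moreover have "vec_append n m v w \<in> {..<n + m} \<rightarrow>\<^sub>E \<O>"
      using O[OF vw(1,2)] vw(3,4) by (rule iffD2[OF _ conjI])
    ultimately have "vec_append n m v w \<in> {vec_append n m v w | v w. v \<in> V \<and> w \<in> W} \<inter> ({..<n + m} \<rightarrow>\<^sub>E \<O>)"
      by (rule IntI)
    from imageI[OF this, of "red (n + m)"]
    show "x \<in> red (n + m) ` ({vec_append n m v w | v w. v \<in> V \<and> w \<in> W} \<inter> ({..<n + m} \<rightarrow>\<^sub>E \<O>))"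
      by (simp only: vw(5) red_append)
  qed
qed

lemma directory_morphism_specialization:
  assumes S: "subring S K" "S \<subseteq> \<O>"
  shows "directory_morphism (K\<lparr>carrier := S\<rparr>) (Dir (\<lambda>a. a) K (self_module K))
    (Dir res k (self_module k)) (specialization K \<O> \<mm>)"
proof -
  have VM: "V \<subseteq> {..<n} \<rightarrow>\<^sub>E carrier K"
    if "Module.submodule V K (module_power n (self_module K))" for V n
    using that unfolding submodule_power_iff by blast
  show ?thesis
    unfolding directory_morphism_def
  proof (intro conjI allI impI ballI)
    fix n :: nat
    show "specialization K \<O> \<mm> n \<in> carrier (sort (Dir (\<lambda>a. a) K (self_module K)) n)
        \<rightarrow> carrier (sort (Dir res k (self_module k)) n)"
      using submodule_specialization by (auto simp: Dir_simps)
    show "isotone (sort (Dir (\<lambda>a. a) K (self_module K)) n) (sort (Dir res k (self_module k)) n)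
        (specialization K \<O> \<mm> n)"
    proof (rule isotoneI)
      fix V W assume "V \<in> carrier (sort (Dir (\<lambda>a. a) K (self_module K)) n)"
        "W \<in> carrier (sort (Dir (\<lambda>a. a) K (self_module K)) n)"
        "V \<sqsubseteq>\<^bsub>sort (Dir (\<lambda>a. a) K (self_module K)) n\<^esub> W"
      then show "specialization K \<O> \<mm> n V \<sqsubseteq>\<^bsub>sort (Dir res k (self_module k)) n\<^esub> specialization K \<O> \<mm> n W"
        using specialization_eq[OF VM] by (auto simp: Dir_simps)
    qed (simp_all add: Dir_def weak_partial_order_Sub)
  next
    fix n :: nat and g V
    assume "g \<in> GL n (K\<lparr>carrier := S\<rparr>)" "V \<in> carrier (sort (Dir (\<lambda>a. a) K (self_module K)) n)"
    then show "specialization K \<O> \<mm> n (gl_act (Dir (\<lambda>a. a) K (self_module K)) n g V)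
        = gl_act (Dir res k (self_module k)) n g (specialization K \<O> \<mm> n V)"
      using specialization_mat_vec[OF S _ VM] by (simp add: Dir_simps gl_act_Dir_self_module)
  next
    fix n m :: nat and V W
    assume "V \<in> carrier (sort (Dir (\<lambda>a. a) K (self_module K)) n)"
      "W \<in> carrier (sort (Dir (\<lambda>a. a) K (self_module K)) m)"
    then show "specialization K \<O> \<mm> (n + m) (osum (Dir (\<lambda>a. a) K (self_module K)) n m V W)
        = osum (Dir res k (self_module k)) n m (specialization K \<O> \<mm> n V) (specialization K \<O> \<mm> m W)"
      unfolding Dir_simps(3) using specialization_osum[OF VM VM] by (simp add: Dir_simps)
  qed
qed

end

section \<open>A field as a module over itself\<close>

lemma (in module) left_module: "left_module R M"
  by unfold_locales (simp_all add: smult_l_distr smult_r_distr smult_assoc1)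

text \<open>If \<open>x\<close> is a nonzero element of \<open>N\<close>, then each \<open>y\<close>
  equals \<open>y \<otimes> (inv x \<otimes> x)\<close> and so lies in \<open>N\<close>.\<close>

lemma (in field) self_module_submodule_cases:
  assumes N: "Module.submodule N R (self_module R)"
  shows "N = {\<zero>} \<or> N = carrier R"
proof (cases "N \<subseteq> {\<zero>}")
  case True
  moreover have "\<zero> \<in> N"
    using subgroup.one_closed[OF Module.submodule.axioms(1)[OF N]] by (simp add: self_module_def)
  ultimately show ?thesis by blast
next
  case False
  have NR: "N \<subseteq> carrier R"
    using module.submoduleE(1)[OF module_self N] by (simp add: self_module_def)
  obtain x where x: "x \<in> N" "x \<noteq> \<zero>" using False by blast
  then have ix: "inv x \<in> carrier R" "inv x \<otimes> x = \<one>" using NR by (auto simp: field_Units)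
  have smult: "a \<otimes> y \<in> N" if "a \<in> carrier R" "y \<in> N" for a y
    using Module.submodule.smult_closed[OF N that] by (simp add: self_module_def)
  have "y \<in> N" if "y \<in> carrier R" for y
    using smult[OF that smult[OF ix(1) x(1)]] that ix by simp
  then show ?thesis using NR by blast
qed

lemma (in cring) submodule_self_module:
  "Module.submodule (carrier R) R (self_module R)" "Module.submodule {\<zero>} R (self_module R)"
proof -
  have "LinearCombinations.submodule R (carrier R) (self_module R)"
    by (rule LinearCombinations.submodule.intro[OF module_self]) (simp_all add: self_module_def)
  moreover have "LinearCombinations.submodule R {\<zero>} (self_module R)"
    by (rule LinearCombinations.submodule.intro[OF module_self]) (simp_all add: self_module_def)
  ultimately show "Module.submodule (carrier R) R (self_module R)"
    "Module.submodule {\<zero>} R (self_module R)"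
    by (simp_all only: module.submodule_iff_closed[OF module_self])
qed

lemma (in field) semisimple_of_length_self_module: "semisimple_of_length R (self_module R) 1"
  unfolding semisimple_of_length_def
proof
  interpret M: module R "self_module R" by (rule module_self)
  have carr: "(self_module R)\<lparr>carrier := carrier R\<rparr> = self_module R" by (simp add: self_module_def)
  have nontrivial: "carrier R \<noteq> {\<zero>}" using one_closed one_not_zero by (metis singletonD)
  have simple: "simple_module R (self_module R)"
    unfolding simple_module_def
  proof (intro conjI allI impI)
    show "carrier (self_module R) \<noteq> {\<zero>\<^bsub>self_module R\<^esub>}"
      using nontrivial by (simp add: self_module_def)
    show "N = {\<zero>\<^bsub>self_module R\<^esub>} \<or> N = carrier (self_module R)"
      if "Module.submodule N R (self_module R)" for N
      using self_module_submodule_cases[OF that] by (simp add: self_module_def)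
  qed
  \<comment> \<open>The decomposition has a single simple summand, the field itself, so a family of
    summands is just its value at \<open>0\<close>.\<close>
  have sum: "(\<Oplus>\<^bsub>self_module R\<^esub>i\<in>{..<1::nat}. s i) = s 0" if "s 0 \<in> carrier R" for s
  proof -
    have "{..<1::nat} = {0}" by auto
    then show ?thesis using that finsum_insert[of "{}" 0 s] by (simp add: finsum_self_module)
  qed
  have "bij_betw (\<lambda>s. \<Oplus>\<^bsub>self_module R\<^esub>i\<in>{..<1::nat}. s i) (\<Pi>\<^sub>E i\<in>{..<1}. carrier R) (carrier R)"
  proof (rule bij_betwI[where g="\<lambda>x. \<lambda>i\<in>{..<1}. x"])
    show "(\<lambda>s. \<Oplus>\<^bsub>self_module R\<^esub>i\<in>{..<1::nat}. s i) \<in> (\<Pi>\<^sub>E i\<in>{..<1}. carrier R) \<rightarrow> carrier R"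
      using sum by (intro funcsetI) (simp add: PiE_coord)
    show "(\<lambda>i\<in>{..<1}. \<Oplus>\<^bsub>self_module R\<^esub>i\<in>{..<1::nat}. s i) = s" if "s \<in> (\<Pi>\<^sub>E i\<in>{..<1}. carrier R)" for s
      using that sum[of s] PiE_coord[OF that, of 0] by (intro PiE_ext[OF _ that]) simp_all
    show "(\<Oplus>\<^bsub>self_module R\<^esub>i\<in>{..<1::nat}. (\<lambda>i\<in>{..<1}. x) i) = x" if "x \<in> carrier R" for x
      using that sum[of "\<lambda>i\<in>{..<1}. x"] by simp
    show "(\<lambda>x. \<lambda>i\<in>{..<1}. x) \<in> carrier R \<rightarrow> (\<Pi>\<^sub>E i\<in>{..<1::nat}. carrier R)"
      by (intro funcsetI restrict_PiE_iff[THEN iffD2]) simp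
  qed
  then show "semisimple_module R (self_module R)"
    unfolding semisimple_module_def
    using simple submodule_self_module(1) carr
    by (intro exI[of _ "1::nat"] exI[of _ "\<lambda>_. carrier R"]) (simp add: self_module_def)
  show "module_length R (self_module R) = enat 1"
  proof (rule module_length_eqI)
    define C where "C = (\<lambda>i::nat. if i = 0 then {\<zero>} else carrier R)"
    show "Module.submodule (C i) R (self_module R)" for i
      using submodule_self_module by (simp add: C_def)
    show "C i \<subset> C (Suc i)" if "i < 1" for i
      using that nontrivial by (auto simp: C_def)
    fix l D assume D: "\<And>i. i \<le> l \<Longrightarrow> Module.submodule (D i) R (self_module R)"
      "\<And>i. i < l \<Longrightarrow> D i \<subset> D (Suc i)"
    show "l \<le> 1"
    proof (rule ccontr)
      assume "\<not> l \<le> 1"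
      \<comment> \<open>A chain of length two would need three distinct submodules, but only two
        exist.\<close>
      then have "D 0 \<subset> D 1" "D 1 \<subset> D 2" using D(2)[of 0] D(2)[of 1] by (simp_all add: numeral_2_eq_2)
      moreover have "D i = {\<zero>} \<or> D i = carrier R" if "i \<le> 2" for i
        using that \<open>\<not> l \<le> 1\<close> by (intro self_module_submodule_cases D(1)) simp
      from this[of 0] this[of 1] this[of 2] have "D 0 = {\<zero>} \<or> D 0 = carrier R"
        "D 1 = {\<zero>} \<or> D 1 = carrier R" "D 2 = {\<zero>} \<or> D 2 = carrier R" by simp_all
      ultimately show False using zero_closed by blast
    qed
  qed
qed

theorem theorem4p3:
  fixes K :: "('a, 'x) ring_scheme" and K\<^sub>0 \<O> \<mm> :: "'a set"
  assumes "field K" and "subfield K\<^sub>0 K" and "infinite K\<^sub>0"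
    and "valuation_ring \<O> K" and "K\<^sub>0 \<subseteq> \<O>"
    and "maximalideal \<mm> (K\<lparr>carrier := \<O>\<rparr>)"
  shows "inflator 1 K\<^sub>0 K (residue K \<O> \<mm>) (residue_field K \<O> \<mm>)
    (self_module (residue_field K \<O> \<mm>)) (specialization K \<O> \<mm>)"
proof -
  interpret residue_map K \<O> \<mm>
    using assms by (simp add: residue_map_def residue_map_axioms_def)
  interpret k: field k by (rule field_k)
  have sub: "subring K\<^sub>0 K" using subfieldE(1)[OF assms(2)] by (simp add: subcring_def)
  \<comment> \<open>Since \<open>K\<^sub>0\<close> lies in \<open>\<O>\<close>, the residue map
    restricts to a homomorphism on the base field, and this restriction is the structure map of the
    residue field as an algebra.\<close>
  have "res \<in> ring_hom (K\<lparr>carrier := K\<^sub>0\<rparr>) k"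
    using assms(5) by (intro ring_hom_memI) (simp_all add: subsetD res_closed res_mult res_add res_one)
  then have alg: "field_algebra (K\<lparr>carrier := K\<^sub>0\<rparr>) k res"
    unfolding field_algebra_def
    using subfield_iff(2)[OF assms(2)] k.is_ring k.m_comm res_closed assms(5) by auto
  show ?thesis
    unfolding inflator_def
    using assms(1-3) alg module.left_module[OF k.module_self] k.semisimple_of_length_self_module
      directory_morphism_specialization[OF sub assms(5)] length_specialization by simp
qed

end
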